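(* Let $X_{4,1}$ be a general element of $Z(4,1)$, i.e. a general disjoint union in $\mathbb{P}^3$ of $4$ double lines and one line. Then $h^i(\mathcal{I}_{X_{4,1}}(6))>0$ for $i=0$ and $i=1$; in other words, $X_{4,1}$ does not have maximal rank in degree $6$.
   Context: We work over an algebraically closed field of characteristic $0$. For a line $L\subset\mathbb{P}^3$, the double line $2L$ is the closed subscheme of $\mathbb{P}^3$ with ideal sheaf $(\mathcal{I}_L)^2$. For $(a,b)\in\mathbb{N}^2\setminus\{(0,0)\}$, $Z(a,b)$ denotes the set of all closed subschemes $X\subset\mathbb{P}^3$ with exactly $a+b$ connected components, $a$ of them being double lines and $b$ of them being lines. It is an irreducible quasi-projective subset of the Hilbert scheme of $\mathbb{P}^3$; a statement about a general element of $Z(a,b)$ means that it holds for all elements of some non-empty Zariski open subset of $Z(a,b)$. A closed subscheme $X\subset\mathbb{P}^3$ has maximal rank in degree $d$ if the restriction map $H^0(\mathcal{O}_{\mathbb{P}^3}(d))\to H^0(\mathcal{O}_X(d))$ is injective or surjective; equivalently, $h^0(\mathcal{I}_X(d))=0$ or $h^1(\mathcal{I}_X(d))=0$. *)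

theory Defs
  imports
    "HOL-Analysis.Analysis"
    "HOL-Computational_Algebra.Polynomial"
    "HOL-Combinatorics.Permutations"
    "HOL-Library.Poly_Mapping"
    "HOL-Library.Extended_Nat"
begin

section \<open>Polynomials and Laurent polynomials\<close>

type_synonym ('v, 'k) mpoly = "('v \<Rightarrow>\<^sub>0 nat) \<Rightarrow>\<^sub>0 'k"

text \<open>
  The homogeneous coordinate ring \<open>S = k[x\<^sub>0, \<dots>, x\<^sub>3]\<close> of projective 3-space, and
  \<open>k[x\<^sub>0, \<dots>, x\<^sub>3, x\<^sub>0\<^sup>-\<^sup>1, \<dots>, x\<^sub>3\<^sup>-\<^sup>1]\<close>. Multiplication is the convolution product of
  \<open>Poly_Mapping\<close>. The index type \<open>4\<close> carries the order \<open>0 < 1 < 2 < 3\<close>.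
\<close>

type_synonym 'k coord_ring = "(4, 'k) mpoly"
type_synonym 'k laurent = "(4 \<Rightarrow>\<^sub>0 int) \<Rightarrow>\<^sub>0 'k"

definition scale :: "'k \<Rightarrow> ('m::monoid_add \<Rightarrow>\<^sub>0 'k::field) \<Rightarrow> ('m \<Rightarrow>\<^sub>0 'k)" where
  "scale c f = Poly_Mapping.single 0 c * f"

definition eval_mpoly :: "('v, 'k::field) mpoly \<Rightarrow> ('v \<Rightarrow> 'k) \<Rightarrow> 'k" where
  "eval_mpoly f x =
     (\<Sum>m\<in>Poly_Mapping.keys f. Poly_Mapping.lookup f m *
        (\<Prod>i\<in>Poly_Mapping.keys m. x i ^ Poly_Mapping.lookup m i))"

definition homogeneous_mpoly :: "nat \<Rightarrow> ('v, 'k::field) mpoly \<Rightarrow> bool" where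
  "homogeneous_mpoly d f \<longleftrightarrow>
     (\<forall>m\<in>Poly_Mapping.keys f. (\<Sum>i\<in>Poly_Mapping.keys m. Poly_Mapping.lookup m i) = d)"

definition homogeneous_laurent :: "int \<Rightarrow> 'k::field laurent \<Rightarrow> bool" where
  "homogeneous_laurent d g \<longleftrightarrow>
     (\<forall>m\<in>Poly_Mapping.keys g. (\<Sum>i\<in>UNIV. Poly_Mapping.lookup m i) = d)"

definition var :: "4 \<Rightarrow> 'k::field coord_ring" where
  "var i = Poly_Mapping.single (Poly_Mapping.single i 1) 1"

definition laurent_var :: "4 \<Rightarrow> 'k::field laurent" where
  "laurent_var i = Poly_Mapping.single (Poly_Mapping.single i 1) 1"

definition to_laurent :: "'k::field coord_ring \<Rightarrow> 'k laurent" where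
  "to_laurent f =
     (\<Sum>m\<in>Poly_Mapping.keys f.
        Poly_Mapping.single (Poly_Mapping.map int m) (Poly_Mapping.lookup f m))"


section \<open>Closed subschemes: lines, double lines and the sets \<open>Z(a, b)\<close>\<close>

text \<open>
  A closed subscheme \<open>X\<close> of projective 3-space is represented by its saturated homogeneous
  ideal \<open>I\<close> in \<open>S\<close> (so that the ideal sheaf of \<open>X\<close> is the sheaf associated with \<open>I\<close>); this
  is a bijection. The whole space is the ideal \<open>{0}\<close>. The ideal of a disjoint union is the
  intersection of the ideals.
\<close>

definition ideal_product :: "'k::field coord_ring set \<Rightarrow> 'k coord_ring set \<Rightarrow> 'k coord_ring set"
  where "ideal_product I J = module.span (*) {f * g | f g. f \<in> I \<and> g \<in> J}"

definition saturation :: "'k::field coord_ring set \<Rightarrow> 'k coord_ring set" where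
  "saturation I = {f. \<forall>i. \<exists>n. var i ^ n * f \<in> I}"

text \<open>A line of projective 3-space is a 2-dimensional linear subspace of \<open>k\<^sup>4\<close>.\<close>

definition is_line :: "('k::field ^ 4) set \<Rightarrow> bool" where
  "is_line L \<longleftrightarrow> vec.subspace L \<and> vec.dim L = 2"

text \<open>
  Over an infinite field the polynomials vanishing on the affine cone \<open>L\<close> form a homogeneous
  ideal, which is the one generated by the linear forms vanishing on \<open>L\<close>.
\<close>

definition line_scheme :: "('k::field ^ 4) set \<Rightarrow> 'k coord_ring set" where
  "line_scheme L = {f. \<forall>v\<in>L. eval_mpoly f (\<lambda>i. v $ i) = 0}"

definition double_line_scheme :: "('k::field ^ 4) set \<Rightarrow> 'k coord_ring set" where
  "double_line_scheme L = saturation (ideal_product (line_scheme L) (line_scheme L))"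

definition disjoint_lines :: "('k::field ^ 4) set \<Rightarrow> ('k ^ 4) set \<Rightarrow> bool" where
  "disjoint_lines L M \<longleftrightarrow> L \<inter> M = {0}"

definition Z :: "nat \<Rightarrow> nat \<Rightarrow> 'k::field coord_ring set set" where
  "Z a b =
     {(\<Inter>L\<in>A. double_line_scheme L) \<inter> (\<Inter>M\<in>B. line_scheme M) | A B.
        finite A \<and> card A = a \<and> finite B \<and> card B = b \<and> A \<inter> B = {} \<and>
        (\<forall>L\<in>A \<union> B. is_line L) \<and> pairwise disjoint_lines (A \<union> B)}"


section \<open>The Zariski topology of the Hilbert scheme\<close>

definition forms :: "nat \<Rightarrow> 'k::field coord_ring set" where
  "forms d = {f. homogeneous_mpoly d f}"

text \<open>
  Pluecker coordinates of the span of a list of polynomials: the maximal minors of the matrix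
  of coefficients, indexed by lists of monomials.
\<close>

definition pluecker :: "'k::field coord_ring list \<Rightarrow> (4 \<Rightarrow>\<^sub>0 nat) list \<Rightarrow> 'k" where
  "pluecker vs ms =
     (if length ms = length vs then
        (\<Sum>\<pi> | \<pi> permutes {..<length vs}. of_int (sign \<pi>) *
           (\<Prod>i<length vs. Poly_Mapping.lookup (vs ! i) (ms ! \<pi> i)))
      else 0)"

definition is_basis_of :: "'k::field coord_ring list \<Rightarrow> 'k coord_ring set \<Rightarrow> bool" where
  "is_basis_of vs V \<longleftrightarrow>
     distinct vs \<and> \<not> module.dependent scale (set vs) \<and> module.span scale (set vs) = V"

text \<open>
  \<open>pluecker_nonvanishing d m F\<close> is the set of points of the Grassmannian of \<open>m\<close>-dimensional
  subspaces of \<open>S\<^sub>d\<close> at which the polynomial \<open>F\<close> in the Pluecker coordinates does not vanish;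
  for homogeneous \<open>F\<close> the choice of the basis does not matter. The topology generated by these
  sets is that of the disjoint union, over all \<open>m\<close>, of the Grassmannians with their Zariski
  topologies.
\<close>

definition pluecker_nonvanishing ::
    "nat \<Rightarrow> nat \<Rightarrow> ((4 \<Rightarrow>\<^sub>0 nat) list, 'k::field) mpoly \<Rightarrow> 'k coord_ring set set" where
  "pluecker_nonvanishing d m F =
     {V. V \<subseteq> forms d \<and>
         (\<exists>vs. length vs = m \<and> is_basis_of vs V \<and> eval_mpoly F (pluecker vs) \<noteq> 0)}"

definition grassmannian_topology :: "nat \<Rightarrow> 'k::field coord_ring set topology" where
  "grassmannian_topology d =
     topology_generated_by {pluecker_nonvanishing d m F | m F. \<exists>n. homogeneous_mpoly n F}"

text \<open>
  For every \<open>d\<close> not smaller than the Gotzmann number of a Hilbert polynomial \<open>P\<close>, the map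
  \<open>X \<mapsto> H\<^sup>0(I\<^sub>X(d)) = I\<^sub>d \<subseteq> S\<^sub>d\<close> is a closed embedding into a Grassmannian of the Hilbert scheme
  for \<open>P\<close>. All elements of \<open>Z a b\<close> have the same Hilbert polynomial, so the topology which
  \<open>Z a b\<close> inherits from the Hilbert scheme is the one pulled back from the Grassmannian of
  subspaces of \<open>S\<^sub>d\<close>, for any sufficiently large \<open>d\<close>.
\<close>

definition zariski_open_in_Z :: "nat \<Rightarrow> nat \<Rightarrow> 'k::field coord_ring set set \<Rightarrow> bool" where
  "zariski_open_in_Z a b W \<longleftrightarrow>
     (\<forall>\<^sub>F d in sequentially.
        openin (pullback_topology (Z a b) (\<lambda>X. X \<inter> forms d) (grassmannian_topology d)) W)"

definition general_in_Z :: "nat \<Rightarrow> nat \<Rightarrow> ('k::field coord_ring set \<Rightarrow> bool) \<Rightarrow> bool" where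
  "general_in_Z a b P \<longleftrightarrow> (\<exists>W. zariski_open_in_Z a b W \<and> W \<noteq> {} \<and> (\<forall>X\<in>W. P X))"


section \<open>Cohomology of twisted ideal sheaves\<close>

text \<open>
  Cohomology is Cech cohomology for the cover by the four affine open sets \<open>x\<^sub>i \<noteq> 0\<close>. The
  sections of the sheaf \<open>I(d)\<close> over the set where all \<open>x\<^sub>i\<close>, \<open>i \<in> A\<close>, are nonzero are the elements
  of degree \<open>d\<close> of the localisation of \<open>I\<close> at \<open>\<Prod>i\<in>A. x\<^sub>i\<close>, here as a subset of the ring of
  Laurent polynomials. For \<open>I = UNIV\<close> the sheaf is \<open>\<O>(d)\<close>.
\<close>

definition local_sections ::
    "4 set \<Rightarrow> 'k::field coord_ring set \<Rightarrow> int \<Rightarrow> 'k laurent set" where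
  "local_sections A I d =
     {g. homogeneous_laurent d g \<and>
         (\<exists>n. \<exists>f\<in>I. (\<Prod>i\<in>A. laurent_var i) ^ n * g = to_laurent f)}"

text \<open>Cochains are indexed by strictly increasing lists and extended by 0 to all lists.\<close>

type_synonym 'k cochain = "4 list \<Rightarrow> 'k laurent"

definition cech_cochains :: "nat \<Rightarrow> 'k::field coord_ring set \<Rightarrow> int \<Rightarrow> 'k cochain set" where
  "cech_cochains p I d =
     {s. \<forall>\<sigma>. if length \<sigma> = p + 1 \<and> sorted_wrt (<) \<sigma> then s \<sigma> \<in> local_sections (set \<sigma>) I d
             else s \<sigma> = 0}"

definition cech_differential :: "'k::field cochain \<Rightarrow> 'k cochain" where
  "cech_differential s \<sigma> =
     (if sorted_wrt (<) \<sigma>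
      then \<Sum>j<length \<sigma>. (-1) ^ j * s (take j \<sigma> @ drop (Suc j) \<sigma>)
      else 0)"

definition cech_cocycles :: "nat \<Rightarrow> 'k::field coord_ring set \<Rightarrow> int \<Rightarrow> 'k cochain set" where
  "cech_cocycles p I d = {s \<in> cech_cochains p I d. cech_differential s = (\<lambda>_. 0)}"

definition cech_coboundaries :: "nat \<Rightarrow> 'k::field coord_ring set \<Rightarrow> int \<Rightarrow> 'k cochain set" where
  "cech_coboundaries p I d =
     (case p of 0 \<Rightarrow> {\<lambda>_. 0} | Suc q \<Rightarrow> cech_differential ` cech_cochains q I d)"

text \<open>
  \<open>h_ideal_sheaf p I d\<close> is the dimension of cocycles modulo coboundaries, as the supremum of the sizes of
  finite sets of cocycles that are linearly independent modulo coboundaries.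
\<close>

definition h_ideal_sheaf :: "nat \<Rightarrow> 'k::field coord_ring set \<Rightarrow> int \<Rightarrow> enat" where
  "h_ideal_sheaf p I d =
     Sup {enat (card A) | A. finite A \<and> A \<subseteq> cech_cocycles p I d \<and>
            (\<forall>c. (\<lambda>\<sigma>. \<Sum>s\<in>A. scale (c s) (s \<sigma>)) \<in> cech_coboundaries p I d \<longrightarrow>
                 (\<forall>s\<in>A. c s = 0))}"


section \<open>Maximal rank\<close>

text \<open>
  The sheaf \<open>\<O>\<^sub>X(d)\<close> is \<open>\<O>(d)\<close> modulo \<open>I(d)\<close>, and the charts are affine. So a global section of
  \<open>\<O>\<^sub>X(d)\<close> is the class, modulo 0-cochains of \<open>I(d)\<close>, of a 0-cochain of \<open>\<O>(d)\<close> whose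
  differential is a cochain of \<open>I(d)\<close>.
\<close>

definition structure_sheaf_sections :: "'k::field coord_ring set \<Rightarrow> int \<Rightarrow> 'k cochain set" where
  "structure_sheaf_sections I d =
     {t \<in> cech_cochains 0 UNIV d. cech_differential t \<in> cech_cochains 1 I d}"

definition restriction_injective :: "'k::field coord_ring set \<Rightarrow> int \<Rightarrow> bool" where
  "restriction_injective I d \<longleftrightarrow>
     (\<forall>s\<in>cech_cocycles 0 UNIV d. s \<in> cech_cochains 0 I d \<longrightarrow> s = (\<lambda>_. 0))"

definition restriction_surjective :: "'k::field coord_ring set \<Rightarrow> int \<Rightarrow> bool" where
  "restriction_surjective I d \<longleftrightarrow>
     (\<forall>t\<in>structure_sheaf_sections I d. \<exists>s\<in>cech_cocycles 0 UNIV d.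
        (\<lambda>\<sigma>. s \<sigma> - t \<sigma>) \<in> cech_cochains 0 I d)"

definition maximal_rank :: "'k::field coord_ring set \<Rightarrow> int \<Rightarrow> bool" where
  "maximal_rank I d \<longleftrightarrow> restriction_injective I d \<or> restriction_surjective I d"

end

theory Submission
  imports Defs
begin

text \<open>
  The open set can be taken to be all of \<open>Z 4 1\<close>.

  Let \<open>L\<^sub>1, \<dots>, L\<^sub>4\<close> be the lines that are doubled and \<open>M\<close> the simple one. If \<open>Q\<^sub>A\<close> is an equation of
  a quadric through the three lines of \<open>A\<close>, then the sextic \<open>Q\<^sub>1\<^sub>2\<^sub>3 Q\<^sub>1\<^sub>2\<^sub>4 Q\<^sub>3\<^sub>4\<^sub>M\<close> vanishes twice on
  each \<open>L\<^sub>i\<close> and once on \<open>M\<close>. On the other hand, the four lines have a common transversal \<open>T\<close>, and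
  the scheme \<open>X \<inter> T\<close> contains four double points, of total degree \<open>8\<close>, whereas the sextic forms
  on \<open>T\<close> have dimension \<open>7\<close>. So some section of \<open>\<O>\<^sub>X(6)\<close> is not the restriction of a sextic form:
  one that is \<open>0\<close> away from \<open>2L\<^sub>1\<close> and whose restriction to \<open>T\<close> vanishes simply at \<open>L\<^sub>1 \<inter> T\<close>.
  Its Cech coboundary is a nonzero class in \<open>H\<^sup>1\<close> of the ideal sheaf.
\<close>

subsection \<open>Additive and multiplicative maps on polynomials\<close>

text \<open>Sextic forms have dimension 84, while a double line carries 7 + 2 * 6 = 19 sections of
  degree 6 and a line carries 7. As 4 * 19 + 7 = 83, counting alone predicts a sextic and surjective
  restriction; the substance is that surjectivity fails. The product of quadrics makes the sextic
  explicit, so that no dimension of a space of sections of the structure sheaf has to be computed.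
  Pairwise disjointness is the only condition on the lines that enters, which is why every element
  of \<open>Z 4 1\<close> is covered. Algebraic closedness enters through the transversal, which
  comes from an eigenvector of a 2 by 2 matrix. The obstacle is to write the bad section as a Cech
  cochain. The function that is 1 on one component and 0 on the others is not a polynomial, so it is
  given chart by chart: if \<open>var i ^ N = u i + w i\<close> with \<open>u i\<close> in the ideal
  of the first component and \<open>w i\<close> in that of the rest, then
  \<open>w i / var i ^ N\<close> is such a function on chart \<open>i\<close>.\<close>

lemma poly_mapping_sum_single:
  fixes f :: "'m \<Rightarrow>\<^sub>0 'a::comm_monoid_add"
  shows "f = (\<Sum>m\<in>Poly_Mapping.keys f. Poly_Mapping.single m (Poly_Mapping.lookup f m))"
  by (rule poly_mapping_eqI)
    (simp add: lookup_sum lookup_single when_def in_keys_iff)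

lemma poly_mapping_add_induct [case_names zero single add]:
  fixes f :: "'m \<Rightarrow>\<^sub>0 'a::comm_monoid_add"
  assumes "P 0" and "\<And>m a. P (Poly_Mapping.single m a)"
    and "\<And>f g. P f \<Longrightarrow> P g \<Longrightarrow> P (f + g)"
  shows "P f"
proof -
  have *: "P (\<Sum>m\<in>A. Poly_Mapping.single m (Poly_Mapping.lookup f m))" if "finite A" for A
    using that by induction (use assms in auto)
  show ?thesis
    by (subst poly_mapping_sum_single) (rule *[OF finite_keys])
qed

text \<open>Monomials may cancel in \<open>f + g\<close>, so the three sums run over different sets;
  \<open>h0\<close> makes the cancelled terms contribute nothing.\<close>

lemma sum_keys_add:
  fixes h :: "'m \<Rightarrow> 'a::comm_monoid_add \<Rightarrow> 'r::comm_monoid_add"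
  assumes h0: "\<And>m. h m 0 = 0" and h_add: "\<And>m a b. h m (a + b) = h m a + h m b"
  shows "(\<Sum>m\<in>Poly_Mapping.keys (f + g). h m (Poly_Mapping.lookup (f + g) m)) =
    (\<Sum>m\<in>Poly_Mapping.keys f. h m (Poly_Mapping.lookup f m)) +
    (\<Sum>m\<in>Poly_Mapping.keys g. h m (Poly_Mapping.lookup g m))"
  by (rule setsum_keys_plus_distrib) (use assms in auto)

text \<open>A map given term by term is a ring homomorphism as soon as it respects products of
  single terms. This one argument serves both \<open>subst\<close> and
  \<open>to_laurent\<close>.\<close>

lemma sum_keys_mult:
  fixes h :: "'m::comm_monoid_add \<Rightarrow> 'a::comm_semiring_1 \<Rightarrow> 'r::comm_semiring_1"
  assumes h0: "\<And>m. h m 0 = 0" and h_add: "\<And>m a b. h m (a + b) = h m a + h m b"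
    and h_mult: "\<And>m n a b. h (m + n) (a * b) = h m a * h n b"
  shows "(\<Sum>m\<in>Poly_Mapping.keys (f * g). h m (Poly_Mapping.lookup (f * g) m)) =
    (\<Sum>m\<in>Poly_Mapping.keys f. h m (Poly_Mapping.lookup f m)) *
    (\<Sum>m\<in>Poly_Mapping.keys g. h m (Poly_Mapping.lookup g m))"
proof -
  define H where "H f = (\<Sum>m\<in>Poly_Mapping.keys f. h m (Poly_Mapping.lookup f m))" for f
  have H_add: "H (f + g) = H f + H g" for f g
    unfolding H_def by (rule sum_keys_add[OF h0 h_add])
  have H_single: "H (Poly_Mapping.single m a) = h m a" for m a
    by (simp add: H_def h0)
  have "H (Poly_Mapping.single m a * g) = h m a * H g" for m a
  proof (induction g rule: poly_mapping_add_induct)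
    case (single n b)
    then show ?case by (simp add: mult_single H_single h_mult)
  qed (simp_all add: H_def[of 0] H_add distrib_left)
  then have "H (f * g) = H f * H g"
    by (induction f rule: poly_mapping_add_induct)
      (simp_all add: H_def[of 0] H_add H_single distrib_right)
  then show ?thesis unfolding H_def .
qed

subsection \<open>Substitution\<close>

text \<open>The target is the univariate polynomial ring because forms are to be restricted to
  parametrised lines. The product runs over all variables rather than \<open>keys m\<close>, so that
  exponents add without a change of index set.\<close>

definition subst :: "('v::finite \<Rightarrow> 'k::field poly) \<Rightarrow> ('v, 'k) mpoly \<Rightarrow> 'k poly" where
  "subst \<phi> f = (\<Sum>m\<in>Poly_Mapping.keys f.
     smult (Poly_Mapping.lookup f m) (\<Prod>i\<in>UNIV. \<phi> i ^ Poly_Mapping.lookup m i))"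

lemma subst_0 [simp]: "subst \<phi> 0 = 0"
  and subst_1 [simp]: "subst \<phi> 1 = 1"
  by (simp_all add: subst_def)

lemma subst_add: "subst \<phi> (f + g) = subst \<phi> f + subst \<phi> g"
  unfolding subst_def by (rule sum_keys_add) (auto simp: smult_add_left)

lemma subst_mult: "subst \<phi> (f * g) = subst \<phi> f * subst \<phi> g"
  unfolding subst_def
  by (rule sum_keys_mult)
    (auto simp: smult_add_left lookup_add power_add prod.distrib mult_ac)

lemma subst_uminus: "subst \<phi> (- f) = - subst \<phi> f"
  using subst_add[of \<phi> f "- f"] by (simp add: add_eq_0_iff)

lemma subst_diff: "subst \<phi> (f - g) = subst \<phi> f - subst \<phi> g"
  using subst_add[of \<phi> f "- g"] by (simp add: subst_uminus)

lemma subst_power: "subst \<phi> (f ^ n) = subst \<phi> f ^ n"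
  by (induction n) (simp_all add: subst_mult)

lemma subst_sum: "subst \<phi> (sum g A) = (\<Sum>a\<in>A. subst \<phi> (g a))"
  by (induction A rule: infinite_finite_induct) (simp_all add: subst_add)

lemma subst_single:
  "subst \<phi> (Poly_Mapping.single m a) =
    smult a (\<Prod>i\<in>UNIV. \<phi> i ^ Poly_Mapping.lookup m i)"
  by (simp add: subst_def)

lemma subst_scale: "subst \<phi> (scale c f) = smult c (subst \<phi> f)"
  by (simp add: scale_def subst_mult subst_single)

lemma subst_var [simp]: "subst \<phi> (var i) = \<phi> i"
proof -
  have "(\<Prod>j\<in>UNIV. \<phi> j ^ Poly_Mapping.lookup (Poly_Mapping.single i 1) j) =
    (\<Prod>j\<in>UNIV. if j = i then \<phi> i else 1)"
    by (rule prod.cong) (auto simp: lookup_single when_def)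
  then show ?thesis
    by (simp add: var_def subst_single)
qed

lemma prod_keys_eq_prod_UNIV:
  fixes x :: "'v::finite \<Rightarrow> 'a::comm_monoid_mult"
  shows "(\<Prod>i\<in>Poly_Mapping.keys m. x i ^ Poly_Mapping.lookup m i) =
    (\<Prod>i\<in>UNIV. x i ^ Poly_Mapping.lookup m i)"
  by (rule prod.mono_neutral_left) (auto simp: in_keys_iff)

lemma sum_keys_eq_sum_UNIV:
  fixes m :: "'v::finite \<Rightarrow>\<^sub>0 'a::comm_monoid_add"
  shows "(\<Sum>i\<in>Poly_Mapping.keys m. Poly_Mapping.lookup m i) =
    (\<Sum>i\<in>UNIV. Poly_Mapping.lookup m i)"
  by (rule sum.mono_neutral_left) (auto simp: in_keys_iff)

lemma poly_subst: "poly (subst \<phi> f) s = eval_mpoly f (\<lambda>i. poly (\<phi> i) s)"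
  for f :: "('v::finite, 'k::field) mpoly"
  unfolding subst_def eval_mpoly_def
  by (simp add: poly_sum poly_prod prod_keys_eq_prod_UNIV)

text \<open>Evaluation is substitution of constant polynomials; the algebraic laws of
  \<open>eval_mpoly\<close> are thereby inherited from \<open>subst\<close>.\<close>

lemma eval_mpoly_eq_subst: "eval_mpoly f x = poly (subst (\<lambda>i. [:x i:]) f) 0"
  for f :: "('v::finite, 'k::field) mpoly"
  by (simp add: poly_subst)

lemma eval_mpoly_simps:
  fixes f g :: "('v::finite, 'k::field) mpoly"
  shows "eval_mpoly (0 :: ('v, 'k) mpoly) x = 0" "eval_mpoly (1 :: ('v, 'k) mpoly) x = 1"
    "eval_mpoly (f + g) x = eval_mpoly f x + eval_mpoly g x"
    "eval_mpoly (f - g) x = eval_mpoly f x - eval_mpoly g x"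
    "eval_mpoly (f * g) x = eval_mpoly f x * eval_mpoly g x"
    "eval_mpoly (f ^ n) x = eval_mpoly f x ^ n"
    "eval_mpoly (scale c f) x = c * eval_mpoly f x"
  by (simp_all add: eval_mpoly_eq_subst subst_add subst_diff subst_mult subst_power subst_scale)

lemma eval_mpoly_var [simp]: "eval_mpoly (var i) x = x i"
  by (simp add: eval_mpoly_eq_subst)

subsection \<open>Homogeneous polynomials\<close>

lemma homogeneous_mpoly_0 [simp]: "homogeneous_mpoly d 0"
  by (simp add: homogeneous_mpoly_def)

lemma homogeneous_mpoly_1 [simp]: "homogeneous_mpoly 0 1"
  by (simp add: homogeneous_mpoly_def)

lemma homogeneous_mpoly_add:
  "homogeneous_mpoly d f \<Longrightarrow> homogeneous_mpoly d g \<Longrightarrow> homogeneous_mpoly d (f + g)"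
  using keys_add[of f g] by (auto simp: homogeneous_mpoly_def)

lemma homogeneous_mpoly_uminus:
  "homogeneous_mpoly d f \<Longrightarrow> homogeneous_mpoly d (- f)"
  by (auto simp: homogeneous_mpoly_def in_keys_iff)

lemma homogeneous_mpoly_diff:
  "homogeneous_mpoly d f \<Longrightarrow> homogeneous_mpoly d g \<Longrightarrow> homogeneous_mpoly d (f - g)"
  using homogeneous_mpoly_add[of d f "- g"] homogeneous_mpoly_uminus[of d g] by simp

lemma homogeneous_mpoly_mult:
  fixes f g :: "('v::finite, 'k::field) mpoly"
  assumes "homogeneous_mpoly d f" "homogeneous_mpoly e g"
  shows "homogeneous_mpoly (d + e) (f * g)"
  unfolding homogeneous_mpoly_def sum_keys_eq_sum_UNIV
proof
  fix m assume "m \<in> Poly_Mapping.keys (f * g)"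
  then obtain a b where "m = a + b" "a \<in> Poly_Mapping.keys f" "b \<in> Poly_Mapping.keys g"
    using keys_mult[of f g] by blast
  then show "(\<Sum>i\<in>UNIV. Poly_Mapping.lookup m i) = d + e"
    using assms by (simp add: homogeneous_mpoly_def sum_keys_eq_sum_UNIV lookup_add sum.distrib)
qed

lemma homogeneous_mpoly_power:
  fixes f :: "('v::finite, 'k::field) mpoly"
  shows "homogeneous_mpoly d f \<Longrightarrow> homogeneous_mpoly (n * d) (f ^ n)"
  by (induction n) (auto intro: homogeneous_mpoly_mult)

lemma homogeneous_mpoly_scale:
  "homogeneous_mpoly d f \<Longrightarrow> homogeneous_mpoly d (scale c f)"
  for f :: "('v::finite, 'k::field) mpoly"
  using homogeneous_mpoly_mult[of 0 "Poly_Mapping.single 0 c" d f]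
  by (simp add: scale_def homogeneous_mpoly_def)

lemma homogeneous_mpoly_sum:
  "(\<And>a. a \<in> A \<Longrightarrow> homogeneous_mpoly d (g a)) \<Longrightarrow> homogeneous_mpoly d (sum g A)"
  by (induction A rule: infinite_finite_induct) (auto intro: homogeneous_mpoly_add)

lemma homogeneous_mpoly_var [simp]: "homogeneous_mpoly 1 (var i)"
  by (simp add: homogeneous_mpoly_def var_def)

lemma degree_subst_le:
  fixes f :: "('v::finite, 'k::field) mpoly"
  assumes "homogeneous_mpoly d f" "\<And>i. degree (\<phi> i) \<le> 1"
  shows "degree (subst \<phi> f) \<le> d"
  unfolding subst_def
proof (rule degree_sum_le)
  fix m assume m: "m \<in> Poly_Mapping.keys f"
  have "degree (\<Prod>i\<in>UNIV. \<phi> i ^ Poly_Mapping.lookup m i)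
      \<le> (\<Sum>i\<in>UNIV. degree (\<phi> i ^ Poly_Mapping.lookup m i))"
    using degree_prod_sum_le[of UNIV "\<lambda>i. \<phi> i ^ Poly_Mapping.lookup m i"] by (simp add: o_def)
  also have "\<dots> \<le> (\<Sum>i\<in>UNIV. Poly_Mapping.lookup m i)"
  proof (rule sum_mono)
    fix i
    show "degree (\<phi> i ^ Poly_Mapping.lookup m i) \<le> Poly_Mapping.lookup m i"
      using degree_power_le[of "\<phi> i" "Poly_Mapping.lookup m i"] assms(2)[of i]
        mult_le_mono1[of "degree (\<phi> i)" 1] by (metis le_trans mult_1)
  qed
  also have "\<dots> = d"
    using assms(1) m by (simp add: homogeneous_mpoly_def sum_keys_eq_sum_UNIV)
  finally show "degree (smult (Poly_Mapping.lookup f m)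
      (\<Prod>i\<in>UNIV. \<phi> i ^ Poly_Mapping.lookup m i)) \<le> d"
    using degree_smult_le le_trans by blast
qed simp

subsection \<open>Laurent polynomials\<close>

lemma to_laurent_add: "to_laurent (f + g) = to_laurent f + to_laurent g"
  unfolding to_laurent_def by (rule sum_keys_add) (auto simp: single_add)

lemma map_int_add: "Poly_Mapping.map int (m + n) = Poly_Mapping.map int m + Poly_Mapping.map int n"
  by (rule poly_mapping_eqI) (simp add: lookup_add map.rep_eq when_def)

lemma to_laurent_mult: "to_laurent (f * g) = to_laurent f * to_laurent g"
  unfolding to_laurent_def
  by (rule sum_keys_mult) (auto simp: single_add map_int_add mult_single)

lemma lookup_map_int: "Poly_Mapping.lookup (Poly_Mapping.map int m) i = int (Poly_Mapping.lookup m i)"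
  by (simp add: map.rep_eq when_def)

lemma inj_map_int: "inj (Poly_Mapping.map int)"
  by (rule injI) (metis lookup_map_int of_nat_eq_iff poly_mapping_eqI)

lemma lookup_to_laurent:
  "Poly_Mapping.lookup (to_laurent f) (Poly_Mapping.map int m) = Poly_Mapping.lookup f m"
  unfolding to_laurent_def lookup_sum lookup_single
  by (simp add: inj_eq[OF inj_map_int] when_def in_keys_iff)

lemma lookup_to_laurent_eq_0:
  "m \<notin> range (Poly_Mapping.map int) \<Longrightarrow> Poly_Mapping.lookup (to_laurent f) m = 0"
  unfolding to_laurent_def lookup_sum lookup_single by (intro sum.neutral) (auto simp: when_def)

lemma keys_to_laurent:
  "Poly_Mapping.keys (to_laurent f) = Poly_Mapping.map int ` Poly_Mapping.keys f"
proof (rule set_eqI)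
  fix m
  show "m \<in> Poly_Mapping.keys (to_laurent f) \<longleftrightarrow>
      m \<in> Poly_Mapping.map int ` Poly_Mapping.keys f"
  proof (cases "m \<in> range (Poly_Mapping.map int)")
    case True
    then obtain n where "m = Poly_Mapping.map int n" by blast
    then show ?thesis
      by (simp add: in_keys_iff lookup_to_laurent inj_image_mem_iff[OF inj_map_int])
  next
    case False
    then show ?thesis
      using lookup_to_laurent_eq_0[OF False, of f] by (auto simp: in_keys_iff)
  qed
qed

lemma inj_to_laurent: "inj to_laurent"
  by (rule injI) (metis lookup_to_laurent poly_mapping_eqI)

lemma to_laurent_eq_iff [simp]: "to_laurent f = to_laurent g \<longleftrightarrow> f = g"
  using inj_to_laurent by (auto dest: injD)

lemma to_laurent_single_0 [simp]: "to_laurent (Poly_Mapping.single 0 c) = Poly_Mapping.single 0 c"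
proof -
  have "Poly_Mapping.map int (0 :: 4 \<Rightarrow>\<^sub>0 nat) = 0"
    by (rule poly_mapping_eqI) (simp add: lookup_map_int)
  then show ?thesis by (simp add: to_laurent_def)
qed

lemma to_laurent_0 [simp]: "to_laurent 0 = 0"
  and to_laurent_1 [simp]: "to_laurent 1 = 1"
  using to_laurent_single_0[of 1] by (simp_all add: to_laurent_def)

lemma to_laurent_uminus: "to_laurent (- f) = - to_laurent f"
  using to_laurent_add[of f "- f"] by (simp add: add_eq_0_iff)

lemma to_laurent_diff: "to_laurent (f - g) = to_laurent f - to_laurent g"
  using to_laurent_add[of f "- g"] by (simp add: to_laurent_uminus)

lemma to_laurent_power: "to_laurent (f ^ n) = to_laurent f ^ n"
  by (induction n) (simp_all add: to_laurent_mult)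

lemma to_laurent_prod: "to_laurent (prod g A) = (\<Prod>a\<in>A. to_laurent (g a))"
  by (induction A rule: infinite_finite_induct) (simp_all add: to_laurent_mult)

lemma to_laurent_var: "to_laurent (var i) = laurent_var i"
  by (simp add: to_laurent_def var_def laurent_var_def)

lemma to_laurent_scale: "to_laurent (scale c f) = scale c (to_laurent f)"
  by (simp add: scale_def to_laurent_mult)

lemma homogeneous_to_laurent:
  "homogeneous_laurent (int d) (to_laurent f) \<longleftrightarrow> homogeneous_mpoly d f"
  by (auto simp: homogeneous_laurent_def homogeneous_mpoly_def keys_to_laurent lookup_map_int
      sum_keys_eq_sum_UNIV simp flip: of_nat_sum)

subsection \<open>Ideals of lines and double lines\<close>

interpretation ideal: module "(*) :: 'k::field coord_ring \<Rightarrow> 'k coord_ring \<Rightarrow> 'k coord_ring"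
  by unfold_locales (auto simp: algebra_simps)

(* as a rewrite rule it loops together with associativity *)
declare ideal.scale_scale [simp del]

text \<open>The parametrisation is affine, \<open>s\<close> going to \<open>p + s q\<close>: the
  point \<open>q\<close> of the projective line is left at infinity, and divisibility by powers of
  \<open>[:- s, 1:]\<close> measures vanishing at the other points.\<close>

definition restrict_line :: "'k::field ^ 4 \<Rightarrow> 'k ^ 4 \<Rightarrow> 'k coord_ring \<Rightarrow> 'k poly" where
  "restrict_line p q = subst (\<lambda>i. [:p $ i, q $ i:])"

lemma poly_restrict_line:
  "poly (restrict_line p q f) s = eval_mpoly f (\<lambda>i. (p + s *s q) $ i)"
  by (simp add: restrict_line_def poly_subst)

lemma degree_restrict_line_le:
  "homogeneous_mpoly d f \<Longrightarrow> degree (restrict_line p q f) \<le> d"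
  unfolding restrict_line_def by (rule degree_subst_le) auto

lemma restrict_line_add: "restrict_line p q (f + g) = restrict_line p q f + restrict_line p q g"
  and restrict_line_diff: "restrict_line p q (f - g) = restrict_line p q f - restrict_line p q g"
  and restrict_line_mult: "restrict_line p q (f * g) = restrict_line p q f * restrict_line p q g"
  and restrict_line_power: "restrict_line p q (f ^ n) = restrict_line p q f ^ n"
  and restrict_line_var: "restrict_line p q (var i) = [:p $ i, q $ i:]"
  by (simp_all add: restrict_line_def subst_add subst_diff subst_mult subst_power)

lemma subspace_line_scheme: "ideal.subspace (line_scheme L)"
  by (rule ideal.subspaceI) (auto simp: line_scheme_def eval_mpoly_simps)

lemma subspace_ideal_product: "ideal.subspace (ideal_product I J)"
  by (simp add: ideal_product_def)

lemma subspace_saturation: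
  assumes I: "ideal.subspace I"
  shows "ideal.subspace (saturation I)"
proof (rule ideal.subspaceI)
  fix f g assume fg: "f \<in> saturation I" "g \<in> saturation I"
  show "f + g \<in> saturation I"
    unfolding saturation_def
  proof (rule CollectI, rule allI)
    fix i
    obtain m n where mn: "var i ^ m * f \<in> I" "var i ^ n * g \<in> I"
      using fg unfolding saturation_def by blast
    have "var i ^ (m + n) * (f + g) = var i ^ n * (var i ^ m * f) + var i ^ m * (var i ^ n * g)"
      by (simp add: algebra_simps power_add)
    also have "\<dots> \<in> I"
      using mn by (intro ideal.subspace_add[OF I] ideal.subspace_scale[OF I, of "_ * _"])
    finally show "\<exists>n. var i ^ n * (f + g) \<in> I" ..
  qed
next
  fix c f assume f: "f \<in> saturation I"
  show "c * f \<in> saturation I"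
    unfolding saturation_def
  proof (rule CollectI, rule allI)
    fix i
    obtain m where "var i ^ m * f \<in> I"
      using f by (auto simp: saturation_def)
    then have "var i ^ m * (c * f) \<in> I"
      using ideal.subspace_scale[OF I, of "var i ^ m * f" c] by (simp add: mult_ac)
    then show "\<exists>n. var i ^ n * (c * f) \<in> I" ..
  qed
qed (use ideal.subspace_0[OF I] in \<open>auto simp: saturation_def\<close>)

lemma subspace_double_line_scheme: "ideal.subspace (double_line_scheme L)"
  unfolding double_line_scheme_def by (intro subspace_saturation subspace_ideal_product)

lemma mult_in_double_line_scheme:
  assumes "f \<in> line_scheme L" "g \<in> line_scheme L"
  shows "f * g \<in> double_line_scheme L"
proof -
  have "var i ^ 0 * (f * g) \<in> ideal_product (line_scheme L) (line_scheme L)" for i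
    unfolding ideal_product_def by (simp, rule ideal.span_base) (use assms in auto)
  then show ?thesis
    unfolding double_line_scheme_def saturation_def by blast
qed

lemma double_line_scheme_mult:
  "f \<in> double_line_scheme L \<Longrightarrow> g * f \<in> double_line_scheme L"
  using ideal.subspace_scale[OF subspace_double_line_scheme] .

lemma line_scheme_mult: "f \<in> line_scheme L \<Longrightarrow> g * f \<in> line_scheme L"
  using ideal.subspace_scale[OF subspace_line_scheme] .

lemma dvd_restrict_line:
  assumes "f \<in> line_scheme L" "p + s *s q \<in> L"
  shows "[:- s, 1:] dvd restrict_line p q f"
  unfolding poly_eq_0_iff_dvd[symmetric] poly_restrict_line
  using assms unfolding line_scheme_def by blast

text \<open>As \<open>f\<close> does not vanish at \<open>s\<close>, the whole order of vanishing of
  the product there is due to \<open>g\<close>. The two linear factors are split off one after the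
  other.\<close>

lemma square_dvd_mult_cancel:
  fixes f g :: "'k::field poly"
  assumes "[:- s, 1:] ^ 2 dvd f * g" "poly f s \<noteq> 0"
  shows "[:- s, 1:] ^ 2 dvd g"
proof -
  have "poly (f * g) s = 0"
    using assms(1) by (metis dvd_power dvd_trans poly_eq_0_iff_dvd zero_less_numeral)
  then have "[:- s, 1:] dvd g"
    using assms(2) by (simp add: poly_eq_0_iff_dvd)
  then obtain h where h: "g = [:- s, 1:] * h" ..
  have "[:- s, 1:] * [:- s, 1:] dvd [:- s, 1:] * (f * h)"
    using assms(1) unfolding h power2_eq_square by (simp only: mult_ac)
  then have "[:- s, 1:] dvd f * h"
    by (subst (asm) dvd_mult_cancel_left) simp
  then have "[:- s, 1:] dvd h"
    using assms(2) by (simp flip: poly_eq_0_iff_dvd)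
  then show ?thesis
    unfolding h power2_eq_square by (rule mult_dvd_mono[OF dvd_refl])
qed

lemma square_dvd_restrict_line_cancel_var:
  assumes "[:- s, 1:] ^ 2 dvd restrict_line p q (var i ^ n * f)" "(p + s *s q) $ i \<noteq> 0"
  shows "[:- s, 1:] ^ 2 dvd restrict_line p q f"
proof (rule square_dvd_mult_cancel)
  show "[:- s, 1:] ^ 2 dvd [:p $ i, q $ i:] ^ n * restrict_line p q f"
    using assms(1) by (simp add: restrict_line_mult restrict_line_power restrict_line_var)
  show "poly ([:p $ i, q $ i:] ^ n) s \<noteq> 0"
    using assms(2) by simp
qed

text \<open>A line through a point of \<open>L\<close> meets the double line there with multiplicity
  at least 2: each factor of a product of two forms through \<open>L\<close> contributes one
  zero.\<close>

lemma square_dvd_restrict_line: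
  assumes f: "f \<in> double_line_scheme L" and L: "p + s *s q \<in> L" and nz: "p + s *s q \<noteq> 0"
  shows "[:- s, 1:] ^ 2 dvd restrict_line p q f"
proof -
  \<comment> \<open>Saturation gives membership in the ideal square only after multiplication by a
    power of a coordinate. A coordinate that is nonzero at the point can be cancelled again.\<close>
  obtain i where i: "(p + s *s q) $ i \<noteq> 0"
    using nz by (metis vec_eq_iff zero_index)
  obtain n where "var i ^ n * f \<in> ideal_product (line_scheme L) (line_scheme L)"
    using f by (auto simp: double_line_scheme_def saturation_def)
  then have "[:- s, 1:] ^ 2 dvd restrict_line p q (var i ^ n * f)"
    unfolding ideal_product_def
  proof (induction rule: ideal.span_induct_alt)
    case base
    then show ?case by (simp add: restrict_line_def)
  next
    case (step c x y)
    then obtain g h where x: "x = g * h" "g \<in> line_scheme L" "h \<in> line_scheme L"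
      by blast
    have "[:- s, 1:] ^ 2 dvd restrict_line p q x"
      unfolding x(1) restrict_line_mult power2_eq_square
      by (intro mult_dvd_mono dvd_restrict_line[OF x(2) L] dvd_restrict_line[OF x(3) L])
    then show ?case
      using step.IH by (simp add: restrict_line_add restrict_line_mult)
  qed
  then show ?thesis
    using i by (rule square_dvd_restrict_line_cancel_var)
qed

subsection \<open>Linear forms and frames\<close>

definition linear_form :: "'k::field ^ 4 \<Rightarrow> 'k coord_ring" where
  "linear_form c = (\<Sum>i\<in>UNIV. scale (c $ i) (var i))"

definition pair :: "'k::field ^ 4 \<Rightarrow> 'k ^ 4 \<Rightarrow> 'k" where
  "pair c v = (\<Sum>i\<in>UNIV. c $ i * v $ i)"

lemma homogeneous_linear_form [simp]: "homogeneous_mpoly 1 (linear_form c)"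
  unfolding linear_form_def
  by (intro homogeneous_mpoly_sum homogeneous_mpoly_scale homogeneous_mpoly_var)

lemma restrict_line_linear_form: "restrict_line p q (linear_form c) = [:pair c p, pair c q:]"
proof -
  have "(\<Sum>i\<in>A. smult (c $ i) [:p $ i, q $ i:]) =
      [:\<Sum>i\<in>A. c $ i * p $ i, \<Sum>i\<in>A. c $ i * q $ i:]" for A
    by (induction A rule: infinite_finite_induct) auto
  then show ?thesis
    by (simp add: restrict_line_def linear_form_def subst_sum subst_scale pair_def)
qed

lemma eval_linear_form [simp]: "eval_mpoly (linear_form c) (\<lambda>i. v $ i) = pair c v"
  using poly_restrict_line[of v 0 "linear_form c" 0] by (simp add: restrict_line_linear_form)

lemma pair_add: "pair c (v + w) = pair c v + pair c w"
  and pair_diff: "pair c (v - w) = pair c v - pair c w"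
  and pair_scale: "pair c (r *s v) = r * pair c v"
  and pair_0: "pair c 0 = 0"
  by (simp_all add: pair_def algebra_simps sum.distrib sum_subtractf sum_distrib_left)

lemmas pair_simps = pair_add pair_diff pair_scale pair_0

lemma linear_functional_eq_pair:
  fixes f :: "'k::field ^ 4 \<Rightarrow> 'k"
  assumes "\<And>v w. f (v + w) = f v + f w" "\<And>r v. f (r *s v) = r * f v"
  obtains c where "\<And>v. f v = pair c v"
proof
  fix v
  have f0: "f 0 = 0"
    using assms(2)[of 0 0] by simp
  have "f v = f (\<Sum>i\<in>UNIV. v $ i *s axis i 1)"
    by (simp add: basis_expansion)
  also have "\<dots> = (\<Sum>i\<in>UNIV. v $ i * f (axis i 1))"
    using assms f0 by (simp add: additive.sum[OF additive.intro])
  finally show "f v = pair (\<chi> i. f (axis i 1)) v"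
    by (simp add: pair_def mult.commute)
qed

lemma is_line_obtain_basis:
  fixes L :: "('k::field ^ 4) set"
  assumes "is_line L"
  obtains a b where "L = vec.span {a, b}"
proof -
  from assms have sub: "vec.subspace L" and dim: "vec.dim L = 2"
    by (auto simp: is_line_def)
  obtain B where B: "B \<subseteq> L" "vec.independent B" "L \<subseteq> vec.span B" "card B = 2"
    using vec.basis_exists[of L] dim by metis
  then obtain a b where "B = {a, b}"
    by (auto simp: card_2_iff)
  with B sub have "L = vec.span {a, b}"
    using vec.span_minimal[of B L] by auto
  then show thesis by (rule that)
qed

lemma is_line_subspace: "is_line L \<Longrightarrow> vec.subspace L"
  by (simp add: is_line_def)

text \<open>Two planes in a space of dimension 4 that meet only in 0 span it, since 2 + 2 - 0 =
  4.\<close>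

lemma disjoint_lines_decompose:
  fixes L M :: "('k::field ^ 4) set"
  assumes L: "is_line L" and M: "is_line M" and LM: "disjoint_lines L M"
  obtains x y where "x \<in> L" "y \<in> M" "v = x + y"
proof -
  have "vec.dim {v + w |v w. v \<in> L \<and> w \<in> M} + vec.dim (L \<inter> M) = vec.dim L + vec.dim M"
    using L M by (intro vec.dim_sums_Int) (auto simp: is_line_def)
  then have "vec.dim {v + w |v w. v \<in> L \<and> w \<in> M} = 4"
    using L M LM by (simp add: is_line_def disjoint_lines_def)
  then have "vec.span {v + w |v w. v \<in> L \<and> w \<in> M} = UNIV"
    by (subst vec.dim_eq_full[symmetric]) (simp add: vec.dimension_def card_cart_basis)
  then have "{v + w |v w. v \<in> L \<and> w \<in> M} = UNIV"
    using vec.subspace_sums[OF is_line_subspace[OF L] is_line_subspace[OF M]]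
    by (simp add: vec.span_eq_iff[THEN iffD2])
  then show thesis using that by blast
qed

text \<open>If two lines are disjoint, adapted bases of their cones form a basis of the whole space;
  the covectors are the dual basis.\<close>

lemma frame_of_disjoint_lines:
  fixes L M :: "('k::field ^ 4) set"
  assumes L: "is_line L" "L = vec.span {a1, a2}" and M: "is_line M" "M = vec.span {b1, b2}"
    and LM: "disjoint_lines L M"
  obtains x1 x2 y1 y2 where
    "\<forall>v. v = pair x1 v *s a1 + pair x2 v *s a2 + (pair y1 v *s b1 + pair y2 v *s b2)"
    "pair x1 a1 = 1" "pair x2 a1 = 0" "pair x1 a2 = 0" "pair x2 a2 = 1"
    "pair y1 b1 = 1" "pair y2 b1 = 0" "pair y1 b2 = 0" "pair y2 b2 = 1"
    "\<forall>v\<in>L. pair y1 v = 0 \<and> pair y2 v = 0"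
    "\<forall>v\<in>M. pair x1 v = 0 \<and> pair x2 v = 0"
proof -
  let ?B = "{a1, a2, b1, b2}"
  have "v \<in> vec.span ?B" for v
  proof -
    obtain x y where "v = x + y" "x \<in> L" "y \<in> M"
      using disjoint_lines_decompose[OF L(1) M(1) LM] by blast
    moreover have "vec.span {a1, a2} \<subseteq> vec.span ?B" "vec.span {b1, b2} \<subseteq> vec.span ?B"
      by (intro vec.span_mono; auto)+
    ultimately show ?thesis
      using L(2) M(2) by (auto intro: vec.span_add)
  qed
  then have span: "vec.span ?B = UNIV" by blast
  have dim4: "vec.dim (UNIV :: ('k ^ 4) set) = 4"
    by (simp add: card_cart_basis)
  \<comment> \<open>Four vectors spanning a space of dimension 4 are distinct and independent, so
    the coordinate functionals below exist.\<close>
  then have card: "card ?B = 4"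
    using vec.dim_le_card[of UNIV ?B] span card_length[of "[a1, a2, b1, b2]"] by simp
  then have ind: "vec.independent ?B"
    using vec.card_le_dim_spanning[of ?B UNIV] span dim4 by simp
  have distinct: "a1 \<noteq> a2" "a1 \<noteq> b1" "a1 \<noteq> b2" "a2 \<noteq> b1" "a2 \<noteq> b2" "b1 \<noteq> b2"
    using card by (auto simp: card_insert_if split: if_splits)
  define R where "R = vec.representation ?B"
  have "\<exists>c. \<forall>v. R v b = pair c v" for b
    by (rule linear_functional_eq_pair[of "\<lambda>v. R v b"])
      (auto simp: R_def vec.representation_add[OF ind] vec.representation_scale[OF ind] span)
  then obtain C where C: "R v b = pair (C b) v" for v b
    by metis
  have basis: "pair (C b) d = (if d = b then 1 else 0)" if "d \<in> ?B" for b d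
    using that vec.representation_basis[OF ind, of d] by (auto simp: R_def simp flip: C)
  have expand: "v = pair (C a1) v *s a1 + pair (C a2) v *s a2 + (pair (C b1) v *s b1 + pair (C b2) v *s b2)" for v
  proof -
    have "v = (\<Sum>b\<in>?B. R v b *s b)"
      unfolding R_def using vec.sum_representation_eq[OF ind, of v ?B] span by simp
    then show ?thesis
      using distinct by (simp add: C add.assoc)
  qed
  show thesis
  proof
    show "\<forall>v. v = pair (C a1) v *s a1 + pair (C a2) v *s a2 +
        (pair (C b1) v *s b1 + pair (C b2) v *s b2)"
      using expand by blast
    show "\<forall>v\<in>L. pair (C b1) v = 0 \<and> pair (C b2) v = 0"
    proof
      fix v assume "v \<in> L"
      then show "pair (C b1) v = 0 \<and> pair (C b2) v = 0"
        unfolding L(2)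
        by (induction rule: vec.span_induct_alt) (use distinct in \<open>auto simp: pair_simps basis\<close>)
    qed
    show "\<forall>v\<in>M. pair (C a1) v = 0 \<and> pair (C a2) v = 0"
    proof
      fix v assume "v \<in> M"
      then show "pair (C a1) v = 0 \<and> pair (C a2) v = 0"
        unfolding M(2)
        by (induction rule: vec.span_induct_alt) (use distinct in \<open>auto simp: pair_simps basis\<close>)
    qed
  qed (use distinct in \<open>auto simp: basis\<close>)
qed

text \<open>Since \<open>L3\<close> is complementary to both \<open>L1\<close> and
  \<open>L2\<close>, it is the graph of an isomorphism from \<open>L1\<close> to \<open>L2\<close>.
  The basis of \<open>L2\<close> is the image of that of \<open>L1\<close>, so \<open>L3\<close>
  gets the equations x = y in the dual coordinates.\<close>

lemma frame_of_three_disjoint_lines: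
  fixes L1 L2 L3 :: "('k::field ^ 4) set"
  assumes lines: "is_line L1" "is_line L2" "is_line L3"
    and disj: "disjoint_lines L1 L2" "disjoint_lines L1 L3" "disjoint_lines L2 L3"
  obtains a1 a2 b1 b2 x1 x2 y1 y2 where
    "L1 = vec.span {a1, a2}" "L2 = vec.span {b1, b2}" "a1 + b1 \<in> L3" "a2 + b2 \<in> L3"
    "pair x1 a1 = 1" "pair x2 a1 = 0" "pair x1 a2 = 0" "pair x2 a2 = 1"
    "pair y1 b1 = 1" "pair y2 b1 = 0" "pair y1 b2 = 0" "pair y2 b2 = 1"
    "\<forall>v\<in>L1. pair y1 v = 0 \<and> pair y2 v = 0"
    "\<forall>v\<in>L2. pair x1 v = 0 \<and> pair x2 v = 0"
    "\<forall>v\<in>L3. pair x1 v = pair y1 v \<and> pair x2 v = pair y2 v"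
proof -
  note sub = lines[THEN is_line_subspace]
  obtain a1 a2 where a: "L1 = vec.span {a1, a2}"
    using is_line_obtain_basis[OF lines(1)] .
  then have a_in: "a1 \<in> L1" "a2 \<in> L1"
    by (auto intro: vec.span_base)
  have graph: "\<exists>b\<in>L2. a + b \<in> L3" for a
  proof -
    obtain y z where yz: "y \<in> L2" "z \<in> L3" "a = y + z"
      using disjoint_lines_decompose[OF lines(2,3) disj(3)] .
    then have "- y \<in> L2" "a + - y \<in> L3"
      using vec.subspace_neg[OF sub(2)] by auto
    then show ?thesis by blast
  qed
  then obtain b1 b2 where b: "b1 \<in> L2" "a1 + b1 \<in> L3" "b2 \<in> L2" "a2 + b2 \<in> L3"
    by metis
  have b_span: "L2 = vec.span {b1, b2}"
  proof
    show "vec.span {b1, b2} \<subseteq> L2"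
      using b sub(2) by (intro vec.span_minimal) auto
    show "L2 \<subseteq> vec.span {b1, b2}"
    proof
      fix y assume y: "y \<in> L2"
      obtain x z where xz: "x \<in> L1" "z \<in> L3" "y = x + z"
        using disjoint_lines_decompose[OF lines(1,3) disj(2)] .
      obtain u v where uv: "x = u *s a1 + v *s a2"
        using xz(1) unfolding a by (auto simp: vec.span_insert vec.span_singleton algebra_simps)
      \<comment> \<open>The left side lies in \<open>L2\<close> and the right side in
        \<open>L3\<close>, so both are 0 and \<open>y\<close> is a combination of \<open>b1\<close>
        and \<open>b2\<close>.\<close>
      have eq: "y + (u *s b1 + v *s b2) = z + (u *s (a1 + b1) + v *s (a2 + b2))"
        unfolding xz(3) uv by (simp add: vec.scale_right_distrib)
      have "y + (u *s b1 + v *s b2) \<in> L2"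
        using y b by (intro vec.subspace_add[OF sub(2)] vec.subspace_scale[OF sub(2)])
      moreover have "y + (u *s b1 + v *s b2) \<in> L3"
        unfolding eq using xz(2) b(2,4)
          vec.subspace_add[OF sub(3)] vec.subspace_scale[OF sub(3)] by metis
      ultimately have "y + (u *s b1 + v *s b2) = 0"
        using disj(3) by (auto simp: disjoint_lines_def)
      then have "y = - (u *s b1 + v *s b2)"
        by (simp only: eq_neg_iff_add_eq_0)
      moreover have "u *s b1 + v *s b2 \<in> vec.span {b1, b2}"
        by (intro vec.span_add vec.span_scale vec.span_base) auto
      ultimately show "y \<in> vec.span {b1, b2}"
        using vec.span_neg by metis
    qed
  qed
  obtain x1 x2 y1 y2 where fr:
    "\<forall>v. v = pair x1 v *s a1 + pair x2 v *s a2 + (pair y1 v *s b1 + pair y2 v *s b2)"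
    "pair x1 a1 = 1" "pair x2 a1 = 0" "pair x1 a2 = 0" "pair x2 a2 = 1"
    "pair y1 b1 = 1" "pair y2 b1 = 0" "pair y1 b2 = 0" "pair y2 b2 = 1"
    "\<forall>v\<in>L1. pair y1 v = 0 \<and> pair y2 v = 0"
    "\<forall>v\<in>L2. pair x1 v = 0 \<and> pair x2 v = 0"
    using frame_of_disjoint_lines[OF lines(1) a lines(2) b_span disj(1)] .
  have "pair x1 v = pair y1 v \<and> pair x2 v = pair y2 v" if v: "v \<in> L3" for v
  proof -
    \<comment> \<open>Subtracting the vector of \<open>L3\<close> with the same coordinates along
      \<open>L1\<close> leaves an element of \<open>L2\<close> that is still in \<open>L3\<close>,
      hence 0.\<close>
    let ?w = "v - (pair x1 v *s (a1 + b1) + pair x2 v *s (a2 + b2))"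
    let ?w' = "(pair y1 v - pair x1 v) *s b1 + (pair y2 v - pair x2 v) *s b2"
    have "?w = ?w'"
      by (subst (1) fr(1)[rule_format, of v]) (simp add: vec.scale_right_distrib vec.scale_left_diff_distrib)
    moreover have "?w \<in> L3"
      using v vec.subspace_scale[OF sub(3) b(2)] vec.subspace_scale[OF sub(3) b(4)]
      by (simp only: vec.subspace_diff[OF sub(3)] vec.subspace_add[OF sub(3)])
    moreover have "?w' \<in> L2"
      using b by (intro vec.subspace_add[OF sub(2)] vec.subspace_scale[OF sub(2)])
    ultimately have "?w' \<in> L2 \<inter> L3"
      by (metis IntI)
    then have "?w' = 0"
      using disj(3) by (simp only: disjoint_lines_def singleton_iff)
    then have "pair y1 ?w' = 0" "pair y2 ?w' = 0"
      by (simp_all add: pair_0)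
    then show ?thesis
      by (simp add: pair_simps fr)
  qed
  then show thesis
    using that[OF a b_span b(2,4) fr(2-11)] by blast
qed

section \<open>Quadrics through three lines, and the transversal of four lines\<close>

text \<open>In the adapted coordinates the three lines are y = 0, x = 0 and x = y. The determinant
  with rows x and y vanishes in each of these cases.\<close>

lemma quadric_through_three_lines:
  fixes L1 L2 L3 :: "('k::field ^ 4) set"
  assumes "is_line L1" "is_line L2" "is_line L3"
    and "disjoint_lines L1 L2" "disjoint_lines L1 L3" "disjoint_lines L2 L3"
  obtains Q where "homogeneous_mpoly 2 Q" "Q \<noteq> 0"
    "Q \<in> line_scheme L1" "Q \<in> line_scheme L2" "Q \<in> line_scheme L3"
proof -
  obtain a1 a2 b1 b2 x1 x2 y1 y2 where fr:
    "L1 = vec.span {a1, a2}" "L2 = vec.span {b1, b2}" "a1 + b1 \<in> L3" "a2 + b2 \<in> L3"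
    "pair x1 a1 = 1" "pair x2 a1 = 0" "pair x1 a2 = 0" "pair x2 a2 = 1"
    "pair y1 b1 = 1" "pair y2 b1 = 0" "pair y1 b2 = 0" "pair y2 b2 = 1"
    "\<forall>v\<in>L1. pair y1 v = 0 \<and> pair y2 v = 0"
    "\<forall>v\<in>L2. pair x1 v = 0 \<and> pair x2 v = 0"
    "\<forall>v\<in>L3. pair x1 v = pair y1 v \<and> pair x2 v = pair y2 v"
    using frame_of_three_disjoint_lines[OF assms] .
  define Q where "Q = linear_form x1 * linear_form y2 - linear_form x2 * linear_form y1"
  have ev: "eval_mpoly Q (\<lambda>i. v $ i) = pair x1 v * pair y2 v - pair x2 v * pair y1 v" for v
    by (simp add: Q_def eval_mpoly_simps)
  have "a1 \<in> L1" "b2 \<in> L2"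
    using fr(1,2) by (auto intro: vec.span_base)
  \<comment> \<open>At \<open>a1 + b2\<close> the rows are (1, 0) and (0, 1), so the determinant is
    that of the identity.\<close>
  then have "eval_mpoly Q (\<lambda>i. (a1 + b2) $ i) = 1"
    unfolding ev by (simp add: pair_add fr)
  then have "Q \<noteq> 0"
    by (auto simp: eval_mpoly_simps)
  moreover have "homogeneous_mpoly 2 Q"
    unfolding Q_def one_add_one[symmetric]
    by (intro homogeneous_mpoly_diff homogeneous_mpoly_mult homogeneous_linear_form)
  ultimately show thesis
    using fr(13-15) by (intro that[of Q]) (auto simp: line_scheme_def ev)
qed

lemma sextic_through_four_double_lines_and_line:
  fixes L1 L2 L3 L4 M :: "('k::field ^ 4) set"
  assumes lines: "is_line L1" "is_line L2" "is_line L3" "is_line L4" "is_line M"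
    and disj: "disjoint_lines L1 L2" "disjoint_lines L1 L3" "disjoint_lines L1 L4"
      "disjoint_lines L2 L3" "disjoint_lines L2 L4" "disjoint_lines L3 L4"
      "disjoint_lines L3 M" "disjoint_lines L4 M"
  obtains F where "homogeneous_mpoly 6 F" "F \<noteq> 0"
    "F \<in> double_line_scheme L1" "F \<in> double_line_scheme L2"
    "F \<in> double_line_scheme L3" "F \<in> double_line_scheme L4" "F \<in> line_scheme M"
proof -
  obtain Q where Q: "homogeneous_mpoly 2 Q" "Q \<noteq> 0"
    "Q \<in> line_scheme L1" "Q \<in> line_scheme L2" "Q \<in> line_scheme L3"
    using quadric_through_three_lines[OF lines(1-3) disj(1,2,4)] .
  obtain R where R: "homogeneous_mpoly 2 R" "R \<noteq> 0"
    "R \<in> line_scheme L1" "R \<in> line_scheme L2" "R \<in> line_scheme L4"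
    using quadric_through_three_lines[OF lines(1,2,4) disj(1,3,5)] .
  obtain S where S: "homogeneous_mpoly 2 S" "S \<noteq> 0"
    "S \<in> line_scheme L3" "S \<in> line_scheme L4" "S \<in> line_scheme M"
    using quadric_through_three_lines[OF lines(3-5) disj(6-8)] .
  have "homogeneous_mpoly (2 + 2 + 2) (Q * R * S)"
    using Q R S by (intro homogeneous_mpoly_mult)
  moreover have "Q * R * S \<noteq> 0"
    using Q R S by simp
  \<comment> \<open>Each of the four lines lies on exactly the two quadrics bracketed together or
    separated from the third factor as needed: \<open>Q\<close> and \<open>R\<close> contain
    \<open>L1\<close> and \<open>L2\<close>, \<open>Q\<close> and \<open>S\<close> contain
    \<open>L3\<close>, \<open>R\<close> and \<open>S\<close> contain \<open>L4\<close>.\<close>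
  moreover have "S * (Q * R) \<in> double_line_scheme L1" "S * (Q * R) \<in> double_line_scheme L2"
    "R * (Q * S) \<in> double_line_scheme L3" "Q * (R * S) \<in> double_line_scheme L4"
    "(Q * R) * S \<in> line_scheme M"
    using Q R S by (auto intro: double_line_scheme_mult mult_in_double_line_scheme line_scheme_mult)
  ultimately show thesis
    by (intro that[of "Q * R * S"]) (simp_all add: mult_ac)
qed

text \<open>The transversal is spanned by an eigenvector of the comparison of the isomorphisms
  \<open>L1 \<rightarrow> L2\<close> with graphs \<open>L3\<close> and \<open>L4\<close>, and its image. It is parametrised
  so that none of the four intersection points is the point at infinity \<open>q\<close>.\<close>

lemma transversal_of_four_disjoint_lines:
  fixes L1 L2 L3 L4 :: "('k::{alg_closed_field, field_char_0} ^ 4) set"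
  assumes lines: "is_line L1" "is_line L2" "is_line L3" "is_line L4"
    and disj: "disjoint_lines L1 L2" "disjoint_lines L1 L3" "disjoint_lines L1 L4"
      "disjoint_lines L2 L3" "disjoint_lines L2 L4" "disjoint_lines L3 L4"
  obtains p q t2 t3 t4 where "p \<in> L1" "p + t2 *s q \<in> L2" "p + t3 *s q \<in> L3" "p + t4 *s q \<in> L4"
    "distinct [0, t2, t3, t4]" "q \<noteq> 0" "\<forall>t. p + t *s q \<noteq> 0"
proof -
  note sub = lines[THEN is_line_subspace]
  obtain a1 a2 b1 b2 x1 x2 y1 y2 where fr:
    "L1 = vec.span {a1, a2}" "L2 = vec.span {b1, b2}" "a1 + b1 \<in> L3" "a2 + b2 \<in> L3"
    "pair x1 a1 = 1" "pair x2 a1 = 0" "pair x1 a2 = 0" "pair x2 a2 = 1"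
    "pair y1 b1 = 1" "pair y2 b1 = 0" "pair y1 b2 = 0" "pair y2 b2 = 1"
    "\<forall>v\<in>L1. pair y1 v = 0 \<and> pair y2 v = 0"
    "\<forall>v\<in>L2. pair x1 v = 0 \<and> pair x2 v = 0"
    "\<forall>v\<in>L3. pair x1 v = pair y1 v \<and> pair x2 v = pair y2 v"
    using frame_of_three_disjoint_lines[OF lines(1-3) disj(1,2,4)] .
  have a: "a1 \<in> L1" "a2 \<in> L1" and b: "b1 \<in> L2" "b2 \<in> L2"
    using fr(1,2) by (auto intro: vec.span_base)
  have graph: "\<exists>u v. a + (u *s b1 + v *s b2) \<in> L4" for a
  proof -
    obtain y z where yz: "y \<in> L2" "z \<in> L4" "a = y + z"
      using disjoint_lines_decompose[OF lines(2,4) disj(5)] .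
    then have "- y \<in> L2"
      using vec.subspace_neg[OF sub(2)] by auto
    then obtain u v where "- y = u *s b1 + v *s b2"
      unfolding fr(2) by (auto simp: vec.span_insert vec.span_singleton algebra_simps)
    moreover have "a + - y = z"
      using yz by simp
    ultimately show ?thesis
      using yz(2) by metis
  qed
  obtain m11 m21 where m1: "a1 + (m11 *s b1 + m21 *s b2) \<in> L4"
    using graph by blast
  obtain m12 m22 where m2: "a2 + (m12 *s b1 + m22 *s b2) \<in> L4"
    using graph by blast
  \<comment> \<open>\<open>L4\<close> is the graph of the map with matrix \<open>m\<close>, while
    \<open>L3\<close> is the graph of the identity in these bases. An eigenvector of
    \<open>m\<close> thus gives points on all four lines within one plane of vectors.\<close>
  obtain u v s where uv: "u \<noteq> 0 \<or> v \<noteq> 0" "u * m11 + v * m12 = s * u" "u * m21 + v * m22 = s * v"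
  proof (cases "m21 = 0")
    case True
    then show thesis by (intro that[of 1 0 m11]) auto
  next
    case False
    \<comment> \<open>This is the characteristic polynomial; for a root \<open>s\<close>, the second
      row gives the eigenvector \<open>(s - m22, m21)\<close>, which is nonzero because
      \<open>m21\<close> is.\<close>
    let ?c = "[:m11 * m22 - m12 * m21, - (m11 + m22), 1:]"
    obtain s where "poly ?c s = 0"
      using alg_closed_imp_poly_has_root[of ?c] by auto
    with False show thesis
      by (intro that[of "s - m22" m21 s]) (auto simp: algebra_simps)
  qed
  define p1 p2 where "p1 = u *s a1 + v *s a2" and "p2 = u *s b1 + v *s b2"
  have p1: "p1 \<in> L1"
    unfolding p1_def using a
    by (intro vec.subspace_add[OF sub(1)] vec.subspace_scale[OF sub(1)])
  have p2: "p2 \<in> L2"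
    unfolding p2_def using b
    by (intro vec.subspace_add[OF sub(2)] vec.subspace_scale[OF sub(2)])
  have p3: "p1 + p2 \<in> L3"
  proof -
    have "p1 + p2 = u *s (a1 + b1) + v *s (a2 + b2)"
      by (simp add: p1_def p2_def vec.scale_right_distrib)
    then show ?thesis
      using fr(3,4) vec.subspace_add[OF sub(3)] vec.subspace_scale[OF sub(3)] by metis
  qed
  have p4: "p1 + s *s p2 \<in> L4"
  proof -
    have "u *s (m11 *s b1 + m21 *s b2) + v *s (m12 *s b1 + m22 *s b2) =
      (u * m11 + v * m12) *s b1 + (u * m21 + v * m22) *s b2"
      by (simp add: vec.scale_right_distrib vec.scale_left_distrib)
    then have "p1 + s *s p2 = u *s (a1 + (m11 *s b1 + m21 *s b2)) + v *s (a2 + (m12 *s b1 + m22 *s b2))"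
      unfolding uv p1_def p2_def by (simp add: vec.scale_right_distrib add_ac)
    then show ?thesis
      using m1 m2 vec.subspace_add[OF sub(4)] vec.subspace_scale[OF sub(4)] by metis
  qed
  have p1_nz: "p1 \<noteq> 0"
  proof
    assume "p1 = 0"
    then have "pair x1 p1 = 0" "pair x2 p1 = 0"
      by (simp_all add: pair_0)
    then show False
      using uv(1) by (simp add: p1_def pair_simps fr)
  qed
  have p2_nz: "p2 \<noteq> 0"
  proof
    assume "p2 = 0"
    then have "pair y1 p2 = 0" "pair y2 p2 = 0"
      by (simp_all add: pair_0)
    then show False
      using uv(1) by (simp add: p2_def pair_simps fr)
  qed
  have indep: "x = 0 \<and> y = 0" if "x *s p1 + y *s p2 = 0" for x y
  proof -
    have "x *s p1 = (- y) *s p2"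
      using that by (simp add: eq_neg_iff_add_eq_0)
    moreover have "x *s p1 \<in> L1" "(- y) *s p2 \<in> L2"
      using p1 p2 vec.subspace_scale[OF sub(1)] vec.subspace_scale[OF sub(2)] by blast+
    ultimately have "x *s p1 \<in> {0}"
      using disj(1) unfolding disjoint_lines_def by (metis IntI)
    with that show ?thesis
      using p1_nz p2_nz by simp
  qed
  have sum_nz: "p1 + p2 \<noteq> 0"
  proof
    assume "p1 + p2 = 0"
    with indep[of 1 1] show False by simp
  qed
  have "s \<noteq> 0"
  proof
    assume "s = 0"
    with p1 p4 have "p1 \<in> L1 \<inter> L4" by simp
    then show False using disj(3) p1_nz by (simp only: disjoint_lines_def singleton_iff)
  qed
  have "s \<noteq> 1"
  proof
    assume "s = 1"
    with p3 p4 have "p1 + p2 \<in> L3 \<inter> L4" by simp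
    then show False using disj(6) sum_nz by (simp only: disjoint_lines_def singleton_iff)
  qed
  \<comment> \<open>The three excluded values are those for which \<open>q = e p1 + p2\<close> would
    itself be the point on \<open>L2\<close>, \<open>L3\<close> or \<open>L4\<close>. The parameters
    below solve for the ratio of the coefficients \<open>1 + t e\<close> of \<open>p1\<close> and
    \<open>t\<close> of \<open>p2\<close>.\<close>
  obtain e where e: "e \<notin> {0, 1, 1 / s}"
    using ex_new_if_finite[OF infinite_UNIV_char_0, of "{0, 1, 1 / s}"] by auto
  then have e': "1 - e \<noteq> 0" "1 - e * s \<noteq> 0" "e \<noteq> 0"
    using \<open>s \<noteq> 0\<close> by (auto simp: field_simps)
  define q where "q = e *s p1 + p2"
  have pq: "p1 + t *s q = (1 + t * e) *s p1 + t *s p2" for t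
    by (simp add: q_def vec.scale_right_distrib vec.scale_left_distrib)
  show thesis
  proof
    show "p1 \<in> L1" by (rule p1)
    have "p1 + (- 1 / e) *s q = (- 1 / e) *s p2"
      using e' unfolding pq by simp
    then show "p1 + (- 1 / e) *s q \<in> L2"
      using vec.subspace_scale[OF sub(2) p2] by metis
    have "p1 + (1 / (1 - e)) *s q = (1 / (1 - e)) *s (p1 + p2)"
    proof -
      have "1 + 1 / (1 - e) * e = 1 / (1 - e)"
        using e' by (simp add: field_simps)
      then show ?thesis
        unfolding pq vec.scale_right_distrib by (simp only:)
    qed
    then show "p1 + (1 / (1 - e)) *s q \<in> L3"
      using vec.subspace_scale[OF sub(3) p3] by metis
    have "p1 + (s / (1 - e * s)) *s q = (1 / (1 - e * s)) *s (p1 + s *s p2)"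
    proof -
      have "1 + s / (1 - e * s) * e = 1 / (1 - e * s)" "1 / (1 - e * s) * s = s / (1 - e * s)"
        using e' by (simp_all add: field_simps)
      then show ?thesis
        unfolding pq vec.scale_right_distrib vec.scale_scale by (simp only:)
    qed
    then show "p1 + (s / (1 - e * s)) *s q \<in> L4"
      using vec.subspace_scale[OF sub(4) p4] by metis
    show "distinct [0, - 1 / e, 1 / (1 - e), s / (1 - e * s)]"
      using e' \<open>s \<noteq> 0\<close> \<open>s \<noteq> 1\<close> by (auto simp: field_simps)
    show "q \<noteq> 0"
      using indep[of e 1] by (auto simp: q_def)
    show "\<forall>t. p1 + t *s q \<noteq> 0"
    proof (intro allI notI)
      fix t assume "p1 + t *s q = 0"
      with indep[of "1 + t * e" t] show False by (auto simp: pq)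
    qed
  qed
qed

subsection \<open>Cech cochains\<close>

lemma laurent_var_prod: "(\<Prod>i\<in>A. laurent_var i) = to_laurent (\<Prod>i\<in>A. var i)"
  by (simp add: to_laurent_prod to_laurent_var)

lemma homogeneous_laurent_add:
  "homogeneous_laurent d f \<Longrightarrow> homogeneous_laurent d g \<Longrightarrow> homogeneous_laurent d (f + g)"
  using keys_add[of f g] by (auto simp: homogeneous_laurent_def)

lemma homogeneous_laurent_uminus: "homogeneous_laurent d f \<Longrightarrow> homogeneous_laurent d (- f)"
  by (simp add: homogeneous_laurent_def in_keys_iff)

lemma homogeneous_laurent_mult:
  assumes "homogeneous_laurent d f" "homogeneous_laurent e g"
  shows "homogeneous_laurent (d + e) (f * g)"
  unfolding homogeneous_laurent_def
proof
  fix m assume "m \<in> Poly_Mapping.keys (f * g)"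
  then obtain a b where "m = a + b" "a \<in> Poly_Mapping.keys f" "b \<in> Poly_Mapping.keys g"
    using keys_mult[of f g] by blast
  then show "(\<Sum>i\<in>UNIV. Poly_Mapping.lookup m i) = d + e"
    using assms by (simp add: homogeneous_laurent_def lookup_add sum.distrib)
qed

lemma scale_mult_right: "f * scale c g = scale c (f * g)"
  for f :: "'m::comm_monoid_add \<Rightarrow>\<^sub>0 'k::field"
  by (simp add: scale_def mult.left_commute)

lemma scale_add_right: "scale c (f + g) = scale c f + scale c g"
  by (simp add: scale_def distrib_left)

lemma scale_scale: "scale c (scale d f) = scale (c * d) f"
  by (simp add: scale_def mult_single flip: mult.assoc)

lemma scale_one: "scale 1 f = f"
  by (simp add: scale_def)

lemma scale_zero_left: "scale 0 f = 0"
  and scale_zero_right: "scale c 0 = 0"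
  by (simp_all add: scale_def)

lemma homogeneous_laurent_scale: "homogeneous_laurent d f \<Longrightarrow> homogeneous_laurent d (scale c f)"
  using homogeneous_laurent_mult[of 0 "Poly_Mapping.single 0 c" d f]
  by (simp add: scale_def homogeneous_laurent_def)

lemma to_laurent_in_local_sections:
  "f \<in> I \<Longrightarrow> homogeneous_mpoly d f \<Longrightarrow> to_laurent f \<in> local_sections A I (int d)"
  unfolding local_sections_def homogeneous_to_laurent[symmetric]
  by (auto intro!: exI[of _ 0])

lemma local_sections_add:
  assumes I: "ideal.subspace I" and g: "g \<in> local_sections A I d" "h \<in> local_sections A I d"
  shows "g + h \<in> local_sections A I d"
proof -
  let ?P = "\<Prod>i\<in>A. laurent_var i" and ?p = "\<Prod>i\<in>A. var i"
  obtain m f where f: "f \<in> I" "?P ^ m * g = to_laurent f"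
    using g by (auto simp: local_sections_def)
  obtain n f' where f': "f' \<in> I" "?P ^ n * h = to_laurent f'"
    using g by (auto simp: local_sections_def)
  have "?P ^ (m + n) * (g + h) = ?P ^ n * (?P ^ m * g) + ?P ^ m * (?P ^ n * h)"
    by (simp add: algebra_simps power_add)
  also have "\<dots> = to_laurent (?p ^ n * f + ?p ^ m * f')"
    unfolding f f' by (simp add: to_laurent_add to_laurent_mult to_laurent_power laurent_var_prod)
  finally have "?P ^ (m + n) * (g + h) = to_laurent (?p ^ n * f + ?p ^ m * f')" .
  moreover have "?p ^ n * f + ?p ^ m * f' \<in> I"
    using f f' ideal.subspace_add[OF I] ideal.subspace_scale[OF I] by metis
  ultimately show ?thesis
    using g by (auto simp: local_sections_def homogeneous_laurent_add)
qed

lemma local_sections_scale: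
  assumes I: "ideal.subspace I" and g: "g \<in> local_sections A I d"
  shows "scale c g \<in> local_sections A I d"
proof -
  let ?P = "\<Prod>i\<in>A. laurent_var i"
  obtain m f where f: "f \<in> I" "?P ^ m * g = to_laurent f"
    using g by (auto simp: local_sections_def)
  have "?P ^ m * scale c g = to_laurent (scale c f)"
    using f by (simp add: scale_mult_right to_laurent_scale)
  moreover have "scale c f \<in> I"
    using ideal.subspace_scale[OF I f(1)] by (simp add: scale_def)
  ultimately show ?thesis
    using g by (auto simp: local_sections_def homogeneous_laurent_scale)
qed

lemma local_sections_zero: "ideal.subspace I \<Longrightarrow> 0 \<in> local_sections A I d"
  using ideal.subspace_0[of I]
  by (auto simp: local_sections_def homogeneous_laurent_def intro!: bexI[of _ 0])

lemma local_sections_mono: "I \<subseteq> J \<Longrightarrow> local_sections A I d \<subseteq> local_sections A J d"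
  by (auto simp: local_sections_def)

lemma cech_cochains_mono: "I \<subseteq> J \<Longrightarrow> cech_cochains p I d \<subseteq> cech_cochains p J d"
  using local_sections_mono[of I J _ d] unfolding cech_cochains_def by (auto split: if_splits)

lemma cech_cochains_add_scale:
  assumes I: "ideal.subspace I" and s: "s \<in> cech_cochains p I d" "t \<in> cech_cochains p I d"
  shows "(\<lambda>\<sigma>. s \<sigma> + scale c (t \<sigma>)) \<in> cech_cochains p I d"
  using s unfolding cech_cochains_def
  by (auto intro!: local_sections_add[OF I] local_sections_scale[OF I] simp: scale_zero_right)

lemma cech_differential_add_scale:
  "cech_differential (\<lambda>\<sigma>. s \<sigma> + scale c (t \<sigma>)) =
    (\<lambda>\<sigma>. cech_differential s \<sigma> + scale c (cech_differential t \<sigma>))"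
  by (rule ext) (auto simp: cech_differential_def sum.distrib scale_def distrib_left
      sum_distrib_left mult.left_commute)

lemma cech_differential_edge:
  "i < j \<Longrightarrow> cech_differential s [i, j] = s [j] - s [i]"
  by (simp add: cech_differential_def lessThan_Suc)

lemma cech_differential_triangle:
  "i < j \<Longrightarrow> j < k \<Longrightarrow> cech_differential s [i, j, k] = s [j, k] - s [i, k] + s [i, j]"
  by (simp add: cech_differential_def lessThan_Suc numeral_eq_Suc)

text \<open>A list of length \<open>p + 1\<close> arises by deleting one entry only from a list of
  length \<open>p + 2\<close>. Elsewhere every summand is the default value 0.\<close>

lemma cech_differential_eq_0:
  assumes s: "\<And>\<tau>. length \<tau> \<noteq> p + 1 \<Longrightarrow> s \<tau> = 0" and \<sigma>: "length \<sigma> \<noteq> p + 2"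
  shows "cech_differential s \<sigma> = 0"
proof -
  have "s (take j \<sigma> @ drop (Suc j) \<sigma>) = 0" if "j < length \<sigma>" for j
    using that \<sigma> by (intro s) auto
  then show ?thesis
    by (simp add: cech_differential_def)
qed

lemma cech_differential_0_eqI:
  assumes s: "\<And>\<tau>. length \<tau> \<noteq> 1 \<Longrightarrow> s \<tau> = 0"
    and edges: "\<And>i j. i < j \<Longrightarrow> s [i] = s [j]"
  shows "cech_differential s = (\<lambda>_. 0)"
proof
  fix \<sigma> :: "4 list"
  show "cech_differential s \<sigma> = 0"
  proof (cases "length \<sigma> = 2 \<and> sorted_wrt (<) \<sigma>")
    case True
    then obtain i j where "\<sigma> = [i, j]" "i < j"
      by (auto simp: length_Suc_conv numeral_2_eq_2)
    then show ?thesis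
      by (simp add: cech_differential_edge edges)
  next
    case False
    then show ?thesis
      using cech_differential_eq_0[of 0 s \<sigma>] s by (auto simp: cech_differential_def)
  qed
qed

lemma cech_differential_differential:
  assumes s: "\<And>\<tau>. length \<tau> \<noteq> 1 \<Longrightarrow> s \<tau> = 0"
  shows "cech_differential (cech_differential s) = (\<lambda>_. 0)"
proof
  fix \<sigma> :: "4 list"
  have ds: "cech_differential s \<tau> = 0" if "length \<tau> \<noteq> 1 + 1" for \<tau>
    using cech_differential_eq_0[of 0 s \<tau>] s that by auto
  show "cech_differential (cech_differential s) \<sigma> = 0"
  proof (cases "length \<sigma> = 3 \<and> sorted_wrt (<) \<sigma>")
    case True
    then obtain i j k where "\<sigma> = [i, j, k]" "i < j" "j < k"
      by (auto simp: length_Suc_conv numeral_3_eq_3)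
    then show ?thesis
      using less_trans[of i j k] by (simp add: cech_differential_triangle cech_differential_edge)
  next
    case False
    then show ?thesis
      using cech_differential_eq_0[of 1 "cech_differential s" \<sigma>] ds
      by (auto simp: cech_differential_def[of "cech_differential s"] numeral_3_eq_3)
  qed
qed

lemma cech_cochains_0_eq_0: "s \<in> cech_cochains 0 I d \<Longrightarrow> length \<tau> \<noteq> 1 \<Longrightarrow> s \<tau> = 0"
  by (auto simp: cech_cochains_def split: if_splits)

lemma cech_cochains_0_vertex: "s \<in> cech_cochains 0 I d \<Longrightarrow> s [i] \<in> local_sections {i} I d"
  by (auto simp: cech_cochains_def dest: spec[of _ "[i]"])

lemma cech_cochains_0I:
  assumes "\<And>\<tau>. length \<tau> \<noteq> 1 \<Longrightarrow> s \<tau> = 0" "\<And>i. s [i] \<in> local_sections {i} I d"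
  shows "s \<in> cech_cochains 0 I d"
  unfolding cech_cochains_def
proof (rule CollectI, rule allI)
  fix \<sigma> :: "4 list"
  show "if length \<sigma> = 0 + 1 \<and> sorted_wrt (<) \<sigma> then s \<sigma> \<in> local_sections (set \<sigma>) I d else s \<sigma> = 0"
    using assms by (cases \<sigma>) auto
qed

subsection \<open>Global sections\<close>

lemma constant_cochain_cocycle:
  assumes "F \<in> I" "homogeneous_mpoly d F"
  shows "(\<lambda>\<sigma>. if length \<sigma> = 1 then to_laurent F else 0) \<in> cech_cocycles 0 I (int d)"
  unfolding cech_cocycles_def
  using to_laurent_in_local_sections[OF assms]
  by (auto intro!: cech_cochains_0I cech_differential_0_eqI)

lemma lookup_single_mult:
  fixes g :: "'m::cancel_comm_monoid_add \<Rightarrow>\<^sub>0 'a::comm_semiring_1"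
  shows "Poly_Mapping.lookup (Poly_Mapping.single a 1 * g) (a + m) = Poly_Mapping.lookup g m"
  by (induction g rule: poly_mapping_add_induct)
    (auto simp: mult_single lookup_single when_def distrib_left lookup_add)

lemma laurent_var_power: "laurent_var i ^ n = Poly_Mapping.single (Poly_Mapping.single i (int n)) 1"
  by (induction n) (auto simp: laurent_var_def mult_single simp flip: single_add)

text \<open>Clearing a denominator that is a power of variable \<open>i\<close> leaves every other
  exponent unchanged.\<close>

lemma exponent_nonneg:
  assumes eq: "laurent_var i ^ n * g = to_laurent f" and m: "m \<in> Poly_Mapping.keys g" and "j \<noteq> i"
  shows "Poly_Mapping.lookup m j \<ge> 0"
proof -
  let ?a = "Poly_Mapping.single i (int n)"
  have "?a + m \<in> Poly_Mapping.keys (to_laurent f)"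
    using m lookup_single_mult[of ?a g m]
    unfolding eq[symmetric] laurent_var_power in_keys_iff by simp
  then obtain k where "?a + m = Poly_Mapping.map int k"
    by (auto simp: keys_to_laurent)
  then have "Poly_Mapping.lookup (?a + m) j = int (Poly_Mapping.lookup k j)"
    by (simp add: lookup_map_int)
  then show ?thesis
    using \<open>j \<noteq> i\<close> by (simp add: lookup_add lookup_single)
qed

text \<open>The cocycle condition makes the four local sections equal. Their common value has no
  negative exponent, because each variable is left uninverted on some chart; hence it is a
  form.\<close>

lemma cocycle_0_global:
  assumes s: "s \<in> cech_cocycles 0 UNIV (int d)"
  obtains F where "homogeneous_mpoly d F" "\<And>i. s [i] = to_laurent F"
proof -
  from s have s0: "s \<in> cech_cochains 0 UNIV (int d)" and ds: "cech_differential s = (\<lambda>_. 0)"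
    by (auto simp: cech_cocycles_def)
  define g where "g = s [0]"
  have lt: "s [i] = s [j]" if "i < j" for i j
    using cech_differential_edge[OF that, of s] ds by simp
  have eq: "s [i] = g" for i
    unfolding g_def using lt[of i 0] lt[of 0 i] linorder_less_linear[of i 0] by metis
  have loc: "\<exists>n f. laurent_var i ^ n * g = to_laurent f" for i
    using cech_cochains_0_vertex[OF s0, of i] by (auto simp: eq local_sections_def)
  have range: "m \<in> range (Poly_Mapping.map int)" if "m \<in> Poly_Mapping.keys g" for m
  proof -
    have "Poly_Mapping.lookup m j \<ge> 0" for j
    proof -
      obtain i :: 4 where "j \<noteq> i"
        using zero_neq_one by metis
      then show ?thesis
        using exponent_nonneg that loc[of i] by blast
    qed
    then have "m = Poly_Mapping.map int (Poly_Mapping.map nat m)"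
      by (intro poly_mapping_eqI) (auto simp: map.rep_eq when_def intro: antisym)
    then show ?thesis by blast
  qed
  define F where "F = Poly_Mapping.map_key (Poly_Mapping.map int) g"
  have "g = to_laurent F"
  proof (rule poly_mapping_eqI)
    fix m
    show "Poly_Mapping.lookup g m = Poly_Mapping.lookup (to_laurent F) m"
    proof (cases "m \<in> range (Poly_Mapping.map int)")
      case True
      then show ?thesis
        by (auto simp: lookup_to_laurent F_def map_key.rep_eq[OF inj_map_int])
    next
      case False
      then show ?thesis
        using range[of m] by (auto simp: lookup_to_laurent_eq_0 in_keys_iff)
    qed
  qed
  moreover have "homogeneous_laurent (int d) g"
    using cech_cochains_0_vertex[OF s0, of 0] by (simp add: eq local_sections_def)
  ultimately show thesis
    using that[of F] eq homogeneous_to_laurent by metis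
qed

subsection \<open>Cohomology and maximal rank\<close>

lemma h_ideal_sheaf_posI:
  assumes s: "s \<in> cech_cocycles p I d"
    and indep: "\<And>c. (\<lambda>\<sigma>. scale c (s \<sigma>)) \<in> cech_coboundaries p I d \<Longrightarrow> c = 0"
  shows "h_ideal_sheaf p I d > 0"
proof -
  have "enat (card {s}) \<le> h_ideal_sheaf p I d"
    unfolding h_ideal_sheaf_def
    by (rule Sup_upper) (use s indep in \<open>auto intro!: exI[of _ "{s}"]\<close>)
  then show ?thesis
    by (metis card_1_singleton_iff i0_less le_zero_eq one_enat_def zero_neq_one One_nat_def)
qed

lemma scale_eq_0_iff: "scale c f = 0 \<longleftrightarrow> c = 0 \<or> f = 0"
  by (metis mult.commute nonzero_divide_eq_eq scale_one scale_scale scale_zero_left scale_zero_right)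

lemma h_ideal_sheaf_0_pos:
  assumes "F \<in> I" "homogeneous_mpoly d F" "F \<noteq> 0"
  shows "h_ideal_sheaf 0 I (int d) > 0"
proof (rule h_ideal_sheaf_posI)
  let ?s = "\<lambda>\<sigma> :: 4 list. if length \<sigma> = 1 then to_laurent F else 0"
  show "?s \<in> cech_cocycles 0 I (int d)"
    using assms by (intro constant_cochain_cocycle)
  fix c assume "(\<lambda>\<sigma>. scale c (?s \<sigma>)) \<in> cech_coboundaries 0 I (int d)"
  then have "scale c (?s [0]) = 0"
    unfolding cech_coboundaries_def by (auto dest: fun_cong[of _ _ "[0]"])
  then show "c = 0"
    using \<open>F \<noteq> 0\<close> to_laurent_eq_iff[of F 0] by (simp add: scale_eq_0_iff)
qed

lemma not_restriction_injective:
  assumes "F \<in> I" "homogeneous_mpoly d F" "F \<noteq> 0"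
  shows "\<not> restriction_injective I (int d)"
proof
  let ?s = "\<lambda>\<sigma> :: 4 list. if length \<sigma> = 1 then to_laurent F else 0"
  assume inj: "restriction_injective I (int d)"
  have "?s \<in> cech_cocycles 0 UNIV (int d)" "?s \<in> cech_cocycles 0 I (int d)"
    by (rule constant_cochain_cocycle; use assms in simp)+
  with inj have "?s = (\<lambda>_. 0)"
    by (auto simp: restriction_injective_def cech_cocycles_def)
  then have "?s [0] = 0"
    by metis
  then show False
    using \<open>F \<noteq> 0\<close> to_laurent_eq_iff[of F 0] by simp
qed

text \<open>This is the connecting map of the sequence from the ideal sheaf through the twisted
  structure sheaf to its quotient: a section that does not lift has nonzero image in
  \<open>H\<^sup>1\<close>.\<close>

lemma h_ideal_sheaf_1_pos:
  assumes I: "ideal.subspace I" and ns: "\<not> restriction_surjective I d"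
  shows "h_ideal_sheaf 1 I d > 0"
proof -
  obtain t where t: "t \<in> cech_cochains 0 UNIV d" "cech_differential t \<in> cech_cochains 1 I d"
    and no: "\<And>s. s \<in> cech_cocycles 0 UNIV d \<Longrightarrow> (\<lambda>\<sigma>. s \<sigma> - t \<sigma>) \<notin> cech_cochains 0 I d"
    using ns by (auto simp: restriction_surjective_def structure_sheaf_sections_def)
  show ?thesis
  proof (rule h_ideal_sheaf_posI)
    show "cech_differential t \<in> cech_cocycles 1 I d"
      using t(2) cech_differential_differential[OF cech_cochains_0_eq_0[OF t(1)]]
      by (simp add: cech_cocycles_def)
    fix c assume "(\<lambda>\<sigma>. scale c (cech_differential t \<sigma>)) \<in> cech_coboundaries 1 I d"
    then obtain u where u: "u \<in> cech_cochains 0 I d"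
      and du: "(\<lambda>\<sigma>. scale c (cech_differential t \<sigma>)) = cech_differential u"
      by (auto simp: cech_coboundaries_def)
    show "c = 0"
    proof (rule ccontr)
      assume c: "c \<noteq> 0"
      \<comment> \<open>If \<open>c\<close> times the coboundary of \<open>t\<close> is that of
        \<open>u\<close>, then \<open>t - u / c\<close> is a global form with the same restriction
        as \<open>t\<close>.\<close>
      let ?s = "\<lambda>\<sigma>. t \<sigma> + scale (- 1 / c) (u \<sigma>)"
      have "?s \<in> cech_cochains 0 UNIV d"
        using cech_cochains_mono[of I UNIV 0 d] u
        by (intro cech_cochains_add_scale t(1)) (auto simp: ideal.subspace_UNIV)
      moreover have "cech_differential ?s = (\<lambda>_. 0)"
        unfolding cech_differential_add_scale du[symmetric]
        using c by (simp add: scale_scale) (simp add: scale_def single_uminus)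
      ultimately have "?s \<in> cech_cocycles 0 UNIV d"
        by (simp add: cech_cocycles_def)
      moreover have "(\<lambda>\<sigma>. 0 + scale (- 1 / c) (u \<sigma>)) \<in> cech_cochains 0 I d"
        by (rule cech_cochains_add_scale[OF I _ u])
          (simp add: cech_cochains_def local_sections_zero[OF I])
      then have "(\<lambda>\<sigma>. ?s \<sigma> - t \<sigma>) \<in> cech_cochains 0 I d"
        by simp
      ultimately show False
        using no by blast
    qed
  qed
qed

text \<open>If \<open>J\<^sub>1 + J\<^sub>2\<close> contains a power of each variable, then \<open>G\<close> on the first and \<open>0\<close> on the second of the two
  disjoint schemes glue to a section, given by \<open>G w\<^sub>i / x\<^sub>i\<^sup>N\<close> on the \<open>i\<close>-th chart.\<close>

lemma lift_of_glued_section: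
  fixes J1 J2 :: "'k::field coord_ring set"
  assumes J: "ideal.subspace J1" "ideal.subspace J2"
    and G: "homogeneous_mpoly d G"
    and u: "\<And>i. u i \<in> J1" and w: "\<And>i. w i \<in> J2"
    and w_hom: "\<And>i. homogeneous_mpoly N (w i)"
    and uw: "\<And>i. var i ^ N = u i + w i"
    and surj: "restriction_surjective (J1 \<inter> J2) (int d)"
  obtains F where "homogeneous_mpoly d F"
    "\<forall>i. \<exists>n. var i ^ n * (F - G) \<in> J1" "\<forall>i. \<exists>n. var i ^ n * F \<in> J2"
proof -
  let ?I = "J1 \<inter> J2"
  define inv where "inv i = (Poly_Mapping.single (Poly_Mapping.single i (- int N)) 1 :: 'k laurent)" for i
  define g where "g i = inv i * to_laurent (G * w i)" for i
  have var_inv: "to_laurent (var i ^ N) * inv i = 1" for i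
    by (simp add: to_laurent_power to_laurent_var laurent_var_power inv_def mult_single
        flip: single_add)
  have var_g: "to_laurent (var i ^ N) * g i = to_laurent (G * w i)" for i
    unfolding g_def by (simp add: var_inv flip: mult.assoc)
  have g_hom: "homogeneous_laurent (int d) (g i)" for i
  proof -
    have "homogeneous_laurent (- int N) (inv i)"
      by (simp add: homogeneous_laurent_def inv_def lookup_single when_def)
    moreover have "homogeneous_laurent (int (d + N)) (to_laurent (G * w i))"
      unfolding homogeneous_to_laurent by (intro homogeneous_mpoly_mult G w_hom)
    ultimately show ?thesis
      unfolding g_def using homogeneous_laurent_mult by fastforce
  qed
  define t where "t \<sigma> = (if length \<sigma> = 1 then g (hd \<sigma>) else 0)" for \<sigma> :: "4 list"
  have t0: "t \<tau> = 0" if "length \<tau> \<noteq> 1" for \<tau>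
    using that by (simp add: t_def)
  have t1: "t [i] = g i" for i
    by (simp add: t_def)
  have "t \<in> cech_cochains 0 UNIV (int d)"
  proof (rule cech_cochains_0I[OF t0])
    fix i
    show "t [i] \<in> local_sections {i} UNIV (int d)"
      using g_hom[of i] var_g[of i]
      by (auto simp: local_sections_def t1 to_laurent_power to_laurent_var
          intro!: exI[of _ N] exI[of _ "G * w i"])
  qed
  moreover have "cech_differential t \<in> cech_cochains 1 ?I (int d)"
    unfolding cech_cochains_def
  proof (rule CollectI, rule allI)
    fix \<sigma> :: "4 list"
    show "if length \<sigma> = 1 + 1 \<and> sorted_wrt (<) \<sigma>
      then cech_differential t \<sigma> \<in> local_sections (set \<sigma>) ?I (int d)
      else cech_differential t \<sigma> = 0"
    proof (cases "length \<sigma> = 1 + 1 \<and> sorted_wrt (<) \<sigma>")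
      case True
      then obtain i j where \<sigma>: "\<sigma> = [i, j]" "i < j"
        by (auto simp: length_Suc_conv)
      \<comment> \<open>This is the numerator of \<open>g j - g i\<close> over the denominator
        \<open>(x\<^sub>i x\<^sub>j)\<^sup>N\<close>. It lies in \<open>J2\<close> as written, and
        in \<open>J1\<close> once each \<open>w\<close> is replaced by \<open>var ^ N - u\<close>,
        because the two products of powers cancel.\<close>
      let ?f = "var i ^ N * (G * w j) - var j ^ N * (G * w i)"
      have "?f = var j ^ N * (G * u i) - var i ^ N * (G * u j)"
        unfolding uw by (simp add: algebra_simps)
      then have "?f \<in> J1"
        using u ideal.subspace_diff[OF J(1)] ideal.subspace_scale[OF J(1)] by metis
      moreover have "?f \<in> J2"
        using w ideal.subspace_diff[OF J(2)] ideal.subspace_scale[OF J(2)] by metis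
      moreover have "(\<Prod>i\<in>set \<sigma>. laurent_var i) ^ N * (g j - g i) = to_laurent ?f"
      proof -
        let ?X = "\<lambda>i. to_laurent (var i ^ N)"
        have "(\<Prod>i\<in>set \<sigma>. laurent_var i) ^ N * (g j - g i) =
            ?X i * (?X j * g j) - ?X j * (?X i * g i)"
          using \<sigma> by (simp add: to_laurent_power to_laurent_var power_mult_distrib algebra_simps)
        also have "\<dots> = to_laurent ?f"
          unfolding var_g by (simp add: to_laurent_diff to_laurent_mult)
        finally show ?thesis .
      qed
      moreover have "homogeneous_laurent (int d) (g j - g i)"
        using homogeneous_laurent_add[OF g_hom[of j] homogeneous_laurent_uminus[OF g_hom[of i]]]
        by simp
      ultimately have "g j - g i \<in> local_sections (set \<sigma>) ?I (int d)"
        unfolding local_sections_def by blast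
      then show ?thesis
        using True by (simp add: \<sigma> cech_differential_edge t1)
    next
      case False
      then show ?thesis
        using cech_differential_eq_0[of 0 t \<sigma>] t0 by (auto simp: cech_differential_def)
    qed
  qed
  ultimately have "t \<in> structure_sheaf_sections ?I (int d)"
    by (simp add: structure_sheaf_sections_def)
  then obtain s where s: "s \<in> cech_cocycles 0 UNIV (int d)"
    "(\<lambda>\<sigma>. s \<sigma> - t \<sigma>) \<in> cech_cochains 0 ?I (int d)"
    using surj by (auto simp: restriction_surjective_def)
  obtain F where F: "homogeneous_mpoly d F" "\<And>i. s [i] = to_laurent F"
    using cocycle_0_global[OF s(1)] by blast
  have key: "\<exists>n. var i ^ n * (var i ^ N * F - G * w i) \<in> ?I" for i
  proof -
    have "to_laurent F - g i \<in> local_sections {i} ?I (int d)"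
      using cech_cochains_0_vertex[OF s(2), of i] by (simp add: F t1)
    then obtain n f where f: "f \<in> ?I" "laurent_var i ^ n * (to_laurent F - g i) = to_laurent f"
      by (auto simp: local_sections_def)
    have "to_laurent (var i ^ n * (var i ^ N * F - G * w i)) =
      to_laurent (var i ^ n) * (to_laurent (var i ^ N) * to_laurent F - to_laurent (var i ^ N) * g i)"
      unfolding var_g by (simp add: to_laurent_mult to_laurent_diff)
    also have "\<dots> = to_laurent (var i ^ N) * (laurent_var i ^ n * (to_laurent F - g i))"
      by (simp add: to_laurent_power to_laurent_var algebra_simps)
    also have "\<dots> = to_laurent (var i ^ N * f)"
      unfolding f by (simp add: to_laurent_mult)
    finally have "var i ^ n * (var i ^ N * F - G * w i) = var i ^ N * f"
      by simp
    also have "\<dots> \<in> ?I"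
      using f(1) ideal.subspace_scale[OF J(1)] ideal.subspace_scale[OF J(2)] by blast
    finally show ?thesis ..
  qed
  have "(\<exists>n. var i ^ n * (F - G) \<in> J1) \<and> (\<exists>n. var i ^ n * F \<in> J2)" for i
  proof
    obtain n where n: "var i ^ n * (var i ^ N * F - G * w i) \<in> ?I"
      using key by blast
    \<comment> \<open>From \<open>var i ^ N * G = G * u i + G * w i\<close>: modulo
      \<open>J1\<close> the form \<open>G * w i\<close> is \<open>var i ^ N * G\<close>, whereas
      modulo \<open>J2\<close> it is 0.\<close>
    have "var i ^ (n + N) * (F - G) =
        var i ^ n * (var i ^ N * F - G * w i) - (var i ^ n * G) * u i"
      using arg_cong[OF uw[of i], of "\<lambda>x. var i ^ n * G * x"]
      by (simp add: algebra_simps power_add)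
    also have "\<dots> \<in> J1"
      using n u by (intro ideal.subspace_diff[OF J(1)] ideal.subspace_scale[OF J(1), of "u i"]) auto
    finally show "\<exists>n. var i ^ n * (F - G) \<in> J1" ..
    have "var i ^ (n + N) * F =
        var i ^ n * (var i ^ N * F - G * w i) + (var i ^ n * G) * w i"
      by (simp add: algebra_simps power_add)
    also have "\<dots> \<in> J2"
      using n w by (intro ideal.subspace_add[OF J(2)] ideal.subspace_scale[OF J(2), of "w i"]) auto
    finally show "\<exists>n. var i ^ n * F \<in> J2" ..
  qed
  then show thesis
    using that[OF F(1)] by blast
qed

subsection \<open>Four double lines and one line\<close>

text \<open>Write the variable as \<open>l + m\<close> with \<open>l\<close> vanishing on
  \<open>L\<close> and \<open>m\<close> on \<open>M\<close>. Each term of the cube contains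
  \<open>l\<close> or \<open>m\<close> at least twice, and 3 is the least exponent with this
  property.\<close>

lemma var_cube_disjoint_lines:
  fixes L M :: "('k::field ^ 4) set"
  assumes "is_line L" "is_line M" "disjoint_lines L M"
  obtains u w where "u \<in> double_line_scheme L" "w \<in> double_line_scheme M" "w \<in> line_scheme M"
    "homogeneous_mpoly 3 w" "var i ^ 3 = u + w"
proof -
  obtain a1 a2 where a: "L = vec.span {a1, a2}"
    using is_line_obtain_basis[OF assms(1)] .
  obtain b1 b2 where b: "M = vec.span {b1, b2}"
    using is_line_obtain_basis[OF assms(2)] .
  obtain x1 x2 y1 y2 where fr:
    "\<forall>v. v = pair x1 v *s a1 + pair x2 v *s a2 + (pair y1 v *s b1 + pair y2 v *s b2)"
    "pair x1 a1 = 1" "pair x2 a1 = 0" "pair x1 a2 = 0" "pair x2 a2 = 1"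
    "pair y1 b1 = 1" "pair y2 b1 = 0" "pair y1 b2 = 0" "pair y2 b2 = 1"
    "\<forall>v\<in>L. pair y1 v = 0 \<and> pair y2 v = 0"
    "\<forall>v\<in>M. pair x1 v = 0 \<and> pair x2 v = 0"
    using frame_of_disjoint_lines[OF assms(1) a assms(2) b assms(3)] .
  \<comment> \<open>The \<open>i\<close>-th coordinate of the projection onto \<open>L\<close> along
    \<open>M\<close>: it agrees with \<open>var i\<close> on \<open>L\<close> and is 0 on
    \<open>M\<close>.\<close>
  define m where "m = scale (a1 $ i) (linear_form x1) + scale (a2 $ i) (linear_form x2)"
  define l where "l = var i - m"
  have m_eval: "eval_mpoly m (\<lambda>i. v $ i) = a1 $ i * pair x1 v + a2 $ i * pair x2 v" for v
    by (simp add: m_def eval_mpoly_simps)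
  have m: "m \<in> line_scheme M"
    using fr(11) by (simp add: line_scheme_def m_eval)
  have l: "l \<in> line_scheme L"
    unfolding line_scheme_def
  proof (rule CollectI, rule ballI)
    fix v assume "v \<in> L"
    then have "v = pair x1 v *s a1 + pair x2 v *s a2"
      using fr(1)[rule_format, of v] fr(10) by simp
    then have "v $ i = (pair x1 v *s a1 + pair x2 v *s a2) $ i"
      by (rule arg_cong)
    then show "eval_mpoly l (\<lambda>i. v $ i) = 0"
      by (simp add: l_def eval_mpoly_simps m_eval mult.commute)
  qed
  have m_hom: "homogeneous_mpoly 1 m"
    unfolding m_def by (intro homogeneous_mpoly_add homogeneous_mpoly_scale homogeneous_linear_form)
  have l_hom: "homogeneous_mpoly 1 l"
    unfolding l_def by (intro homogeneous_mpoly_diff m_hom homogeneous_mpoly_var)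
  show thesis
  proof
    show "(l + (m + m + m)) * (l * l) \<in> double_line_scheme L"
      by (intro double_line_scheme_mult mult_in_double_line_scheme l)
    show "(m + (l + l + l)) * (m * m) \<in> double_line_scheme M"
      by (intro double_line_scheme_mult mult_in_double_line_scheme m)
    show "(m + (l + l + l)) * (m * m) \<in> line_scheme M"
      by (intro line_scheme_mult m)
    have "homogeneous_mpoly (1 + (1 + 1)) ((m + (l + l + l)) * (m * m))"
      by (intro homogeneous_mpoly_mult homogeneous_mpoly_add m_hom l_hom)
    then show "homogeneous_mpoly 3 ((m + (l + l + l)) * (m * m))"
      by (simp add: numeral_3_eq_3)
    have "var i = l + m"
      by (simp add: l_def)
    then show "var i ^ 3 = (l + (m + m + m)) * (l * l) + (m + (l + l + l)) * (m * m)"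
      by (simp add: power3_eq_cube algebra_simps)
  qed
qed

text \<open>Multiply the decompositions of \<open>var i ^ 3\<close> for all \<open>M\<close> in
  \<open>B\<close>: the product of the second parts lies in every ideal of \<open>B\<close>, and
  each remaining term contains a factor from the ideal of \<open>L\<close>. Membership in both
  ideals of \<open>M\<close> is recorded so that \<open>B\<close> may mix double and simple
  lines.\<close>

lemma var_power_disjoint_lines:
  fixes L :: "('k::field ^ 4) set"
  assumes "finite B" "is_line L" "\<And>M. M \<in> B \<Longrightarrow> is_line M \<and> disjoint_lines L M"
  shows "\<exists>u w. u \<in> double_line_scheme L \<and>
    (\<forall>M\<in>B. w \<in> double_line_scheme M \<and> w \<in> line_scheme M) \<and>
    homogeneous_mpoly (3 * card B) w \<and> var i ^ (3 * card B) = u + w"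
  using assms(1,3)
proof (induction B)
  case empty
  show ?case
    using ideal.subspace_0[OF subspace_double_line_scheme] by (intro exI[of _ 0] exI[of _ 1]) auto
next
  case (insert M B)
  then obtain u w where uw: "u \<in> double_line_scheme L"
    "\<forall>M\<in>B. w \<in> double_line_scheme M \<and> w \<in> line_scheme M"
    "homogeneous_mpoly (3 * card B) w" "var i ^ (3 * card B) = u + w"
    by auto
  obtain u' w' where uw': "u' \<in> double_line_scheme L" "w' \<in> double_line_scheme M"
    "w' \<in> line_scheme M" "homogeneous_mpoly 3 w'" "var i ^ 3 = u' + w'"
    using var_cube_disjoint_lines[of L M i] insert.prems[of M] assms(2) by auto
  have "homogeneous_mpoly (3 + 3 * card B) (w' * w)"
    using uw uw' by (intro homogeneous_mpoly_mult)
  moreover have "(u + w) * u' + w' * u \<in> double_line_scheme L"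
    using uw uw' by (intro ideal.subspace_add[OF subspace_double_line_scheme] double_line_scheme_mult)
  moreover have "w * w' \<in> double_line_scheme M" "w * w' \<in> line_scheme M"
    using uw' by (auto intro: double_line_scheme_mult line_scheme_mult)
  moreover have "w' * w \<in> double_line_scheme N \<and> w' * w \<in> line_scheme N" if "N \<in> B" for N
    using that uw by (auto intro: double_line_scheme_mult line_scheme_mult)
  moreover have "var i ^ (3 + 3 * card B) = ((u + w) * u' + w' * u) + w' * w"
    unfolding power_add uw uw' by (simp add: algebra_simps)
  ultimately show ?case
    using insert.hyps
    by (intro exI[of _ "(u + w) * u' + w' * u"] exI[of _ "w' * w"]) (auto simp: mult.commute)
qed

text \<open>The zeros at distinct points add up to 2 + 2 + 2 + 1 = 7, more than the degree
  allows.\<close>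

lemma sextic_double_at_three_points_eq_0:
  fixes f :: "'k::field poly"
  assumes "degree f \<le> 6" and "poly f 0 = 0" and t: "distinct [0, t2, t3, t4]"
    and dvd: "[:- t2, 1:] ^ 2 dvd f" "[:- t3, 1:] ^ 2 dvd f" "[:- t4, 1:] ^ 2 dvd f"
  shows "f = 0"
proof (rule ccontr)
  assume "f \<noteq> 0"
  obtain f2 where f2: "f = [:- t2, 1:] ^ 2 * f2"
    using dvd(1) by blast
  have "[:- t3, 1:] ^ 2 dvd f2"
    using dvd(2) unfolding f2 by (rule square_dvd_mult_cancel) (use t in auto)
  then obtain f3 where f3: "f2 = [:- t3, 1:] ^ 2 * f3"
    by blast
  have "[:- t4, 1:] ^ 2 dvd f2"
    using dvd(3) unfolding f2 by (rule square_dvd_mult_cancel) (use t in auto)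
  then have "[:- t4, 1:] ^ 2 dvd f3"
    unfolding f3 by (rule square_dvd_mult_cancel) (use t in auto)
  then obtain f4 where f4: "f3 = [:- t4, 1:] ^ 2 * f4"
    by blast
  have "poly f4 0 = 0"
    using assms(2) t by (simp add: f2 f3 f4)
  then obtain f5 where f5: "f4 = [:0, 1:] * f5"
    using poly_eq_0_iff_dvd[of f4 0] by auto
  have "f5 \<noteq> 0"
    using \<open>f \<noteq> 0\<close> by (auto simp: f2 f3 f4 f5)
  then have "degree f = 7 + degree f5"
    unfolding f2 f3 f4 f5 by (simp add: degree_mult_eq degree_power_eq del: mult_pCons_left)
  then show False
    using assms(1) by simp
qed

text \<open>The hypotheses say that \<open>p\<close> and \<open>q\<close> are independent, so some 2
  by 2 minor of the pair is nonzero; expanding that minor along \<open>p\<close> gives the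
  covector.\<close>

lemma exists_covector_separating:
  fixes p q :: "'k::field ^ 4"
  assumes q: "q \<noteq> 0" and pq: "\<And>t. p + t *s q \<noteq> 0"
  obtains c where "pair c p = 0" "pair c q \<noteq> 0"
proof -
  have pair_axis: "pair (r *s axis i 1 - s *s axis j 1) v = r * v $ i - s * v $ j" for r s i j v
  proof -
    have "pair (axis i 1) v = v $ i" for i
      by (simp add: pair_def axis_def if_distrib[of "\<lambda>x. x * _"] cong: if_cong)
    moreover have "pair (r *s c - s *s d) v = r * pair c v - s * pair d v" for c d
      by (simp add: pair_def algebra_simps sum_subtractf sum_distrib_left)
    ultimately show ?thesis by simp
  qed
  obtain j where j: "q $ j \<noteq> 0"
    using q by (metis vec_eq_iff zero_index)
  \<comment> \<open>This combination has \<open>j\<close>-th coordinate 0, so a nonzero coordinate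
    \<open>i\<close> of it yields the minor.\<close>
  have "p + (- p $ j / q $ j) *s q \<noteq> 0"
    by (rule pq)
  then obtain i where "(p + (- p $ j / q $ j) *s q) $ i \<noteq> 0"
    by (metis vec_eq_iff zero_index)
  then have "p $ i * q $ j - p $ j * q $ i \<noteq> 0"
    using j by (auto simp: field_simps)
  then show thesis
    by (intro that[of "p $ j *s axis i 1 - p $ i *s axis j 1"]) (auto simp: pair_axis)
qed

text \<open>The sextic \<open>G = h k\<^sup>5\<close> restricted to the transversal vanishes simply at \<open>p\<close>. A sextic
  that agrees with \<open>G\<close> on \<open>2 L\<^sub>1\<close> and vanishes on the other double lines would vanish to order
  \<open>1 + 2 + 2 + 2 > 6\<close> on the transversal, hence identically.\<close>

lemma not_restriction_surjective:
  fixes L1 L2 L3 L4 M :: "('k::{alg_closed_field, field_char_0} ^ 4) set"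
  assumes lines: "is_line L1" "is_line L2" "is_line L3" "is_line L4" "is_line M"
    and disj: "disjoint_lines L1 L2" "disjoint_lines L1 L3" "disjoint_lines L1 L4"
      "disjoint_lines L2 L3" "disjoint_lines L2 L4" "disjoint_lines L3 L4" "disjoint_lines L1 M"
  shows "\<not> restriction_surjective (double_line_scheme L1 \<inter>
    (double_line_scheme L2 \<inter> double_line_scheme L3 \<inter> double_line_scheme L4 \<inter> line_scheme M)) 6"
proof
  define J where "J = double_line_scheme L2 \<inter> double_line_scheme L3 \<inter> double_line_scheme L4 \<inter> line_scheme M"
  assume "restriction_surjective (double_line_scheme L1 \<inter>
    (double_line_scheme L2 \<inter> double_line_scheme L3 \<inter> double_line_scheme L4 \<inter> line_scheme M)) 6"
  then have surj: "restriction_surjective (double_line_scheme L1 \<inter> J) (int 6)"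
    by (simp add: J_def)
  obtain p q t2 t3 t4 where T: "p \<in> L1" "p + t2 *s q \<in> L2" "p + t3 *s q \<in> L3" "p + t4 *s q \<in> L4"
    "distinct [0, t2, t3, t4]" "q \<noteq> 0" "\<forall>t. p + t *s q \<noteq> 0"
    using transversal_of_four_disjoint_lines[OF lines(1-4) disj(1-6)] .
  note T7 = T(7)[rule_format]
  obtain h where h: "pair h p = 0" "pair h q \<noteq> 0"
    using exists_covector_separating[OF T(6) T7] .
  \<comment> \<open>The same lemma with the two points exchanged.\<close>
  obtain k where k: "pair k p \<noteq> 0"
  proof -
    have "p \<noteq> 0"
      using T7[of 0] by auto
    moreover have "q + t *s p \<noteq> 0" for t
    proof
      assume eq: "q + t *s p = 0"
      then have "t \<noteq> 0"
        using T(6) by auto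
      then have "p + (1 / t) *s q = (1 / t) *s (q + t *s p)"
        by (simp add: vec.scale_right_distrib)
      then show False
        using T7[of "1 / t"] by (simp add: eq)
    qed
    ultimately show thesis
      using exists_covector_separating[of p q] that by metis
  qed
  define G where "G = linear_form h * linear_form k ^ 5"
  have "homogeneous_mpoly (1 + 5 * 1) G"
    unfolding G_def by (intro homogeneous_mpoly_mult homogeneous_mpoly_power homogeneous_linear_form)
  then have G: "homogeneous_mpoly 6 G"
    by simp
  \<comment> \<open>The exponent stays \<open>3 * card ?B\<close>: gluing works with any exponent
    common to the four variables.\<close>
  let ?B = "{L2, L3, L4, M}"
  have "\<exists>u w. u \<in> double_line_scheme L1 \<and>
      (\<forall>M\<in>?B. w \<in> double_line_scheme M \<and> w \<in> line_scheme M) \<and>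
      homogeneous_mpoly (3 * card ?B) w \<and> var i ^ (3 * card ?B) = u + w" for i
    by (rule var_power_disjoint_lines) (use lines disj in auto)
  then obtain u w where uw: "\<And>i. u i \<in> double_line_scheme L1"
    "\<And>i. \<forall>M\<in>?B. w i \<in> double_line_scheme M \<and> w i \<in> line_scheme M"
    "\<And>i. homogeneous_mpoly (3 * card ?B) (w i)" "\<And>i. var i ^ (3 * card ?B) = u i + w i"
    by metis
  have w: "w i \<in> J" for i
    using uw(2)[of i] by (simp add: J_def)
  have J: "ideal.subspace J"
    unfolding J_def
    by (intro ideal.subspace_inter subspace_double_line_scheme subspace_line_scheme)
  obtain F where F: "homogeneous_mpoly 6 F"
    "\<forall>i. \<exists>n. var i ^ n * (F - G) \<in> double_line_scheme L1" "\<forall>i. \<exists>n. var i ^ n * F \<in> J"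
    using lift_of_glued_section[OF subspace_double_line_scheme J G uw(1) w uw(3,4) surj] .
  have double: "[:- t, 1:] ^ 2 dvd restrict_line p q f"
    if f: "\<forall>i. \<exists>n. var i ^ n * f \<in> double_line_scheme L" and t: "p + t *s q \<in> L" for f L t
  proof -
    obtain i where i: "(p + t *s q) $ i \<noteq> 0"
      using T7[of t] by (metis vec_eq_iff zero_index)
    obtain n where "var i ^ n * f \<in> double_line_scheme L"
      using f by blast
    from square_dvd_restrict_line_cancel_var[OF square_dvd_restrict_line[OF this t T7] i]
    show ?thesis .
  qed
  have FJ: "\<forall>i. \<exists>n. var i ^ n * F \<in> double_line_scheme L" if "L \<in> {L2, L3, L4}" for L
    using F(3) that unfolding J_def by blast
  let ?f = "restrict_line p q F"
  have g: "restrict_line p q G = [:0, 1:] * ([:pair h q:] * [:pair k p, pair k q:] ^ 5)"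
    unfolding G_def restrict_line_mult restrict_line_power restrict_line_linear_form h by simp
  have "[:- 0, 1:] ^ 2 dvd restrict_line p q (F - G)"
    using F(2) T(1) by (intro double[of _ L1]) auto
  then have d0: "[:0, 1:] ^ 2 dvd ?f - restrict_line p q G"
    by (simp only: restrict_line_diff minus_zero)
  have "poly (?f - restrict_line p q G) 0 = 0"
    unfolding poly_eq_0_iff_dvd minus_zero
    using dvd_trans[OF dvd_power[of 2 "[:0, 1:]"] d0] by simp
  then have "poly ?f 0 = 0"
    unfolding g by simp
  moreover have "degree ?f \<le> 6"
    using F(1) by (rule degree_restrict_line_le)
  moreover have "[:- t2, 1:] ^ 2 dvd ?f" "[:- t3, 1:] ^ 2 dvd ?f" "[:- t4, 1:] ^ 2 dvd ?f"
    using double[OF FJ T(2)] double[OF FJ T(3)] double[OF FJ T(4)] by auto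
  ultimately have "?f = 0"
    using sextic_double_at_three_points_eq_0 T(5) by blast
  \<comment> \<open>With \<open>?f = 0\<close>, the square divides the restriction of
    \<open>G\<close>. Cancelling one factor contradicts the simple zero, since \<open>h\<close> is
    nonzero at \<open>q\<close> and \<open>k\<close> at \<open>p\<close>.\<close>
  then have "[:0, 1:] * [:0, 1:] dvd [:0, 1:] * ([:pair h q:] * [:pair k p, pair k q:] ^ 5)"
    using d0 unfolding g power2_eq_square by (simp only: diff_0 dvd_minus_iff)
  then have "[:0, 1:] dvd [:pair h q:] * [:pair k p, pair k q:] ^ 5"
    by (subst (asm) dvd_mult_cancel_left) simp
  then have "poly ([:pair h q:] * [:pair k p, pair k q:] ^ 5) 0 = 0"
    unfolding poly_eq_0_iff_dvd minus_zero .
  then show False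
    using h k by simp
qed

subsection \<open>\<open>Z a b\<close> is open in itself and nonempty\<close>

interpretation coord: vector_space "scale :: 'k::field \<Rightarrow> 'k coord_ring \<Rightarrow> 'k coord_ring"
  by unfold_locales
    (simp_all add: scale_add_right scale_scale scale_one, simp add: scale_def single_add distrib_right)

lemma finite_monomials_of_degree:
  "finite {m :: 'v::finite \<Rightarrow>\<^sub>0 nat. (\<Sum>i\<in>UNIV. Poly_Mapping.lookup m i) = d}" (is "finite ?M")
proof (rule finite_imageD)
  have "Poly_Mapping.lookup m i \<le> d" if "m \<in> ?M" for m i
    using that member_le_sum[of i UNIV "Poly_Mapping.lookup m"] by simp
  then have "Poly_Mapping.lookup ` ?M \<subseteq> PiE UNIV (\<lambda>_. {..d})"
    by (auto simp: PiE_UNIV_domain)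
  then show "finite (Poly_Mapping.lookup ` ?M)"
    by (rule finite_subset) (intro finite_PiE; simp)
  show "inj_on Poly_Mapping.lookup ?M"
    by (rule inj_onI) (simp only: poly_mapping_eq_iff)
qed

lemma forms_finite_dimensional:
  obtains T :: "'k::field coord_ring set" where "finite T" "forms d \<subseteq> coord.span T"
proof
  let ?M = "{m :: 4 \<Rightarrow>\<^sub>0 nat. (\<Sum>i\<in>UNIV. Poly_Mapping.lookup m i) = d}"
  let ?T = "(\<lambda>m. Poly_Mapping.single m 1) ` ?M :: 'k coord_ring set"
  show "finite ?T"
    using finite_monomials_of_degree by (rule finite_imageI)
  show "forms d \<subseteq> coord.span ?T"
  proof
    fix f :: "'k coord_ring" assume "f \<in> forms d"
    then have f: "m \<in> ?M" if "m \<in> Poly_Mapping.keys f" for m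
      using that by (simp add: forms_def homogeneous_mpoly_def sum_keys_eq_sum_UNIV)
    have "f = (\<Sum>m\<in>Poly_Mapping.keys f. scale (Poly_Mapping.lookup f m) (Poly_Mapping.single m 1))"
      by (subst poly_mapping_sum_single) (simp add: scale_def mult_single)
    also have "\<dots> \<in> coord.span ?T"
      using f by (intro coord.span_sum coord.span_scale coord.span_base) blast
    finally show "f \<in> coord.span ?T" .
  qed
qed

lemma graded_part_has_basis:
  assumes X: "ideal.subspace X"
  obtains vs where "is_basis_of vs (X \<inter> forms d)"
proof -
  let ?V = "X \<inter> forms d"
  have "coord.subspace ?V"
  proof (rule coord.subspaceI)
    show "0 \<in> ?V"
      using ideal.subspace_0[OF X] by (simp add: forms_def)
    show "f + g \<in> ?V" if "f \<in> ?V" "g \<in> ?V" for f g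
      using that ideal.subspace_add[OF X] by (simp add: forms_def homogeneous_mpoly_add)
    show "scale c f \<in> ?V" if "f \<in> ?V" for c f
      using that ideal.subspace_scale[OF X, of f "Poly_Mapping.single 0 c"]
      by (simp add: forms_def homogeneous_mpoly_scale) (simp add: scale_def)
  qed
  moreover obtain B where B: "B \<subseteq> ?V" "coord.independent B" "?V \<subseteq> coord.span B"
    using coord.maximal_independent_subset .
  ultimately have "coord.span B = ?V"
    using coord.span_minimal[OF B(1)] by blast
  moreover have "finite B"
    using forms_finite_dimensional[of d] coord.independent_span_bound[OF _ B(2)] B(1)
    by (metis le_inf_iff order_trans)
  then obtain vs where "set vs = B" "distinct vs"
    using finite_distinct_list by blast
  ultimately show thesis
    using B(2) by (intro that[of vs]) (simp add: is_basis_of_def)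
qed

lemma subspace_of_Z:
  assumes "X \<in> Z a b"
  shows "ideal.subspace X"
proof -
  obtain A B where "X = (\<Inter>L\<in>A. double_line_scheme L) \<inter> (\<Inter>M\<in>B. line_scheme M)"
    using assms unfolding Z_def by blast
  then show ?thesis
    by (auto intro!: ideal.subspace_inter ideal.subspace_Inter
        subspace_double_line_scheme subspace_line_scheme)
qed

text \<open>\<open>Z a b\<close> is the preimage of the whole Grassmannian space. What has to be
  checked is that each graded part is a point of that space: it has a finite basis, and the constant
  polynomial 1, homogeneous of degree 0, vanishes nowhere.\<close>

lemma zariski_open_Z: "zariski_open_in_Z a b (Z a b :: 'k::field coord_ring set set)"
  unfolding zariski_open_in_Z_def
proof (rule always_eventually, rule allI)
  fix d
  let ?G = "grassmannian_topology d :: 'k coord_ring set topology"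
  have "X \<inter> forms d \<in> topspace ?G" if X: "X \<in> Z a b" for X :: "'k coord_ring set"
  proof -
    obtain vs where vs: "is_basis_of vs (X \<inter> forms d)"
      using graded_part_has_basis[OF subspace_of_Z[OF X]] .
    let ?F = "1 :: ((4 \<Rightarrow>\<^sub>0 nat) list, 'k) mpoly"
    have "eval_mpoly ?F (pluecker vs) \<noteq> 0"
      by (simp add: eval_mpoly_def)
    then have "X \<inter> forms d \<in> pluecker_nonvanishing d (length vs) ?F"
      using vs unfolding pluecker_nonvanishing_def by blast
    moreover have "homogeneous_mpoly 0 ?F"
      by (simp add: homogeneous_mpoly_def)
    ultimately show ?thesis
      unfolding grassmannian_topology_def topology_generated_by_topspace by blast
  qed
  then have "Z a b = (\<lambda>X. X \<inter> forms d) -` topspace ?G \<inter> Z a b"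
    by blast
  then show "openin (pullback_topology (Z a b) (\<lambda>X. X \<inter> forms d) ?G) (Z a b)"
    unfolding openin_pullback_topology by blast
qed

text \<open>The lines are the graphs of multiplication by \<open>n\<close> on the plane of the first
  two coordinates. In characteristic 0 the scalars are distinct, so two graphs meet only in
  0.\<close>

lemma exists_infinite_family_of_disjoint_lines:
  obtains L :: "nat \<Rightarrow> ('k::field_char_0 ^ 4) set"
  where "\<And>n. is_line (L n)" "\<And>m n. m \<noteq> n \<Longrightarrow> disjoint_lines (L m) (L n)"
proof
  define L where "L n = {v :: 'k ^ 4. v $ 2 = of_nat n * v $ 0 \<and> v $ 3 = of_nat n * v $ 1}" for n
  have four: "i = 0 \<or> i = 1 \<or> i = 2 \<or> i = 3" for i :: 4
    using exhaust_4[of i] by auto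
  show "is_line (L n)" for n
  proof -
    have sub: "vec.subspace (L n)"
      by (rule vec.subspaceI) (auto simp: L_def algebra_simps)
    define a b :: "'k ^ 4" where "a = (\<chi> i. if i = 0 then 1 else if i = 2 then of_nat n else 0)"
      and "b = (\<chi> i. if i = 1 then 1 else if i = 3 then of_nat n else 0)"
    have ab: "a $ 0 = 1" "a $ 1 = 0" "a $ 2 = of_nat n" "a $ 3 = 0"
        "b $ 0 = 0" "b $ 1 = 1" "b $ 2 = 0" "b $ 3 = of_nat n"
      by (simp_all add: a_def b_def)
    have "vec.dim (L n) = 2"
    proof (rule vec.dim_unique)
      show "{a, b} \<subseteq> L n"
        by (auto simp: L_def ab)
      show "L n \<subseteq> vec.span {a, b}"
      proof
        fix v assume "v \<in> L n"
        then have "v $ i = (v $ 0 *s a + v $ 1 *s b) $ i" for i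
          using four[of i] by (elim disjE) (simp_all add: L_def ab mult.commute)
        then have "v = v $ 0 *s a + v $ 1 *s b"
          unfolding vec_eq_iff by blast
        moreover have "v $ 0 *s a + v $ 1 *s b \<in> vec.span {a, b}"
          by (intro vec.span_add vec.span_scale vec.span_base) auto
        ultimately show "v \<in> vec.span {a, b}"
          by metis
      qed
      have ne: "a \<noteq> b"
        using ab by auto
      have "a \<notin> vec.span {b}"
      proof
        assume "a \<in> vec.span {b}"
        then obtain k where "a = k *s b"
          by (auto simp: vec.span_singleton)
        then have "a $ 0 = k * b $ 0"
          by simp
        then show False
          by (simp add: ab)
      qed
      moreover have "b \<noteq> 0"
        using ab by auto
      ultimately show "vec.independent {a, b}"
        using ne by (simp add: vec.independent_insert)
      show "card {a, b} = 2"
        using ne by simp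
    qed
    with sub show ?thesis
      by (simp add: is_line_def)
  qed
  show "disjoint_lines (L m) (L n)" if "m \<noteq> n" for m n
  proof -
    have "v = 0" if "v \<in> L m" "v \<in> L n" for v
    proof -
      have "of_nat m * v $ 0 = of_nat n * v $ 0" "of_nat m * v $ 1 = of_nat n * v $ 1"
        using that by (auto simp: L_def)
      then have "v $ 0 = 0" "v $ 1 = 0"
        using \<open>m \<noteq> n\<close> by auto
      moreover from this have "v $ 2 = 0" "v $ 3 = 0"
        using that by (auto simp: L_def)
      ultimately show ?thesis
        unfolding vec_eq_iff using four by (metis zero_index)
    qed
    then show ?thesis
      by (auto simp: disjoint_lines_def L_def)
  qed
qed

lemma Z_nonempty: "Z a b \<noteq> ({} :: 'k::field_char_0 coord_ring set set)"
proof -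
  obtain L :: "nat \<Rightarrow> ('k ^ 4) set" where L: "\<And>n. is_line (L n)"
    "\<And>m n. m \<noteq> n \<Longrightarrow> disjoint_lines (L m) (L n)"
    using exists_infinite_family_of_disjoint_lines by blast
  have inj: "inj L"
  proof (rule injI, rule ccontr)
    fix m n assume "L m = L n" "m \<noteq> n"
    then have "L n = {0}"
      using L(2)[OF \<open>m \<noteq> n\<close>] by (simp add: disjoint_lines_def)
    then show False
      using L(1)[of n] by (simp add: is_line_def)
  qed
  let ?A = "L ` {..<a}" and ?B = "L ` {a..<a + b}"
  have "card ?A = a" "card ?B = b"
    using inj by (simp_all add: card_image inj_on_subset)
  moreover have "?A \<inter> ?B = {}"
    unfolding image_Int[OF inj, symmetric] by auto
  moreover have "pairwise disjoint_lines (?A \<union> ?B)"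
  proof (rule pairwiseI)
    fix M N assume "M \<in> ?A \<union> ?B" "N \<in> ?A \<union> ?B" "M \<noteq> N"
    then obtain m n where "M = L m" "N = L n" "m \<noteq> n"
      by blast
    then show "disjoint_lines M N"
      using L(2) by simp
  qed
  ultimately have "(\<Inter>L\<in>?A. double_line_scheme L) \<inter> (\<Inter>M\<in>?B. line_scheme M) \<in> Z a b"
    unfolding Z_def using L(1) by (intro CollectI exI[of _ ?A] exI[of _ ?B]) auto
  then show ?thesis
    by blast
qed

section \<open>The result for every element of \<open>Z 4 1\<close>\<close>

text \<open>The bracketing splits off \<open>L1\<close> from the other components, in the shape that
  the gluing argument uses.\<close>

lemma Z_4_1_cases:
  assumes "X \<in> Z 4 1"
  obtains L1 L2 L3 L4 M where
    "X = double_line_scheme L1 \<inter>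
      (double_line_scheme L2 \<inter> double_line_scheme L3 \<inter> double_line_scheme L4 \<inter> line_scheme M)"
    "is_line L1" "is_line L2" "is_line L3" "is_line L4" "is_line M"
    "disjoint_lines L1 L2" "disjoint_lines L1 L3" "disjoint_lines L1 L4"
    "disjoint_lines L2 L3" "disjoint_lines L2 L4" "disjoint_lines L3 L4"
    "disjoint_lines L1 M" "disjoint_lines L3 M" "disjoint_lines L4 M"
proof -
  obtain A B where X: "X = (\<Inter>L\<in>A. double_line_scheme L) \<inter> (\<Inter>M\<in>B. line_scheme M)"
    and AB: "card A = 4" "card B = 1" "A \<inter> B = {}" "\<forall>L\<in>A \<union> B. is_line L"
      "pairwise disjoint_lines (A \<union> B)"
    using assms unfolding Z_def by blast
  obtain M where M: "B = {M}"
    using AB(2) by (auto simp: card_1_singleton_iff)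
  obtain L1 L2 L3 L4 where A: "A = {L1, L2, L3, L4}" and ne: "distinct [L1, L2, L3, L4]"
    using AB(1) by (auto simp: card_Suc_eq numeral_eq_Suc)
  have disj: "disjoint_lines L N" if "L \<in> A \<union> B" "N \<in> A \<union> B" "L \<noteq> N" for L N
    using AB(5) that by (auto simp: pairwise_def)
  have "L1 \<noteq> M" "L3 \<noteq> M" "L4 \<noteq> M"
    using AB(3) by (auto simp: A M)
  moreover have "X = double_line_scheme L1 \<inter>
      (double_line_scheme L2 \<inter> double_line_scheme L3 \<inter> double_line_scheme L4 \<inter> line_scheme M)"
    by (auto simp: X A M)
  ultimately show thesis
    using ne AB(4) by (intro that[of L1 L2 L3 L4 M] disj) (simp_all add: A M)
qed

theorem mainTheorem6:
  shows "general_in_Z 4 1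
    (\<lambda>X :: 'k::{alg_closed_field, field_char_0} coord_ring set.
       h_ideal_sheaf 0 X 6 > 0 \<and> h_ideal_sheaf 1 X 6 > 0 \<and> \<not> maximal_rank X 6)"
  unfolding general_in_Z_def
proof (intro exI[of _ "Z 4 1"] conjI ballI zariski_open_Z Z_nonempty)
  fix X :: "'k coord_ring set"
  assume X: "X \<in> Z 4 1"
  then obtain L1 L2 L3 L4 M where X_eq:
    "X = double_line_scheme L1 \<inter>
      (double_line_scheme L2 \<inter> double_line_scheme L3 \<inter> double_line_scheme L4 \<inter> line_scheme M)"
    and lines: "is_line L1" "is_line L2" "is_line L3" "is_line L4" "is_line M"
    and disj: "disjoint_lines L1 L2" "disjoint_lines L1 L3" "disjoint_lines L1 L4"
      "disjoint_lines L2 L3" "disjoint_lines L2 L4" "disjoint_lines L3 L4"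
      "disjoint_lines L1 M" "disjoint_lines L3 M" "disjoint_lines L4 M"
    by (rule Z_4_1_cases)
  obtain F where F: "homogeneous_mpoly 6 F" "F \<noteq> 0"
    "F \<in> double_line_scheme L1" "F \<in> double_line_scheme L2"
    "F \<in> double_line_scheme L3" "F \<in> double_line_scheme L4" "F \<in> line_scheme M"
    using sextic_through_four_double_lines_and_line[OF lines disj(1-6,8,9)] .
  then have FX: "F \<in> X"
    by (simp add: X_eq)
  have ns: "\<not> restriction_surjective X 6"
    unfolding X_eq by (rule not_restriction_surjective[OF lines disj(1-7)])
  show "h_ideal_sheaf 0 X 6 > 0"
    using h_ideal_sheaf_0_pos[OF FX F(1,2)] by simp
  show "h_ideal_sheaf 1 X 6 > 0"
    using h_ideal_sheaf_1_pos[OF subspace_of_Z[OF X] ns] .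
  show "\<not> maximal_rank X 6"
    using not_restriction_injective[OF FX F(1,2)] ns by (simp add: maximal_rank_def)
qed

end
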